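(* Let $d \geq 1$ and $k \geq 2$ be integers and let $G = C_{2k}^d$ be the $d$th power of the cartesian product of the even cycle $C_{2k}$ with itself. Let $\varphi$ be a proper partial edge coloring of $G$ with colors from $\{1,\dots,2d\}$ in which at most $2d-1$ edges are precolored. Then $\varphi$ can be extended to a proper $2d$-edge coloring of $G$, i.e. there is a proper edge coloring $f : E(G) \to \{1,\dots,2d\}$ such that $f(e) = \varphi(e)$ for every edge $e$ that is colored under $\varphi$.
   Context: $C_n$ denotes the (simple) cycle with $n$ vertices, $n \geq 3$. The cartesian product $G \square H$ of two graphs $G$ and $H$ is the graph with vertex set $V(G)\times V(H)$, where $(u,v)$ is adjacent to $(u',v')$ if and only if $u=u'$ and $vv' \in E(H)$, or $uu' \in E(G)$ and $v=v'$. $G^d$ denotes the $d$-fold cartesian product $G \square G \square \cdots \square G$ ($d$ factors). A proper partial edge coloring (edge precoloring) of $G$ is a proper edge coloring of some subset $E' \subseteq E(G)$, that is, an assignment of colors to the edges of $E'$ such that any two edges of $E'$ sharing an endpoint receive different colors; the edges of $E'$ are the precolored edges. A proper $t$-edge coloring of $G$ is a proper edge coloring of all edges of $G$ with colors from $\{1,\dots,t\}$. *)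

theory Defs
  imports Main
begin

record 'a ugraph =
  verts :: "'a set"
  edges :: "'a set set"

definition simple_graph :: "'a ugraph \<Rightarrow> bool" where
  "simple_graph G \<longleftrightarrow> (\<forall>e\<in>edges G. e \<subseteq> verts G \<and> card e = 2)"

text \<open>This is the simple cycle for \<open>n \<ge> 3\<close>; smaller values degenerate.\<close>

definition cycle_graph :: "nat \<Rightarrow> nat ugraph" where
  "cycle_graph n = \<lparr>verts = {..<n}, edges = {{i, Suc i mod n} | i. i < n}\<rparr>"

definition cart_prod :: "'a ugraph \<Rightarrow> 'b ugraph \<Rightarrow> ('a \<times> 'b) ugraph" where
  "cart_prod G H =
     \<lparr>verts = verts G \<times> verts H,
      edges = {{(u, v), (u', v')} | u v u' v'.
        (u, v) \<in> verts G \<times> verts H \<and> (u', v') \<in> verts G \<times> verts H \<and>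
        (u = u' \<and> {v, v'} \<in> edges H \<or> {u, u'} \<in> edges G \<and> v = v')}\<rparr>"

definition map_graph :: "('a \<Rightarrow> 'b) \<Rightarrow> 'a ugraph \<Rightarrow> 'b ugraph" where
  "map_graph h G = \<lparr>verts = h ` verts G, edges = (\<lambda>e. h ` e) ` edges G\<rparr>"

text \<open>
  The vertices of the \<open>d\<close>-fold product are the lists of length \<open>d\<close> over \<open>verts G\<close>, so that all
  powers live in one type; an iterated pair \<open>(x, xs)\<close> is renamed to \<open>x # xs\<close>. The power with no
  factors is the one-vertex graph, the unit of the product.
\<close>

primrec cart_power :: "'a ugraph \<Rightarrow> nat \<Rightarrow> 'a list ugraph" where
  "cart_power G 0 = \<lparr>verts = {[]}, edges = {}\<rparr>"
| "cart_power G (Suc d) = map_graph (\<lambda>(x, xs). x # xs) (cart_prod G (cart_power G d))"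

definition proper_edge_coloring :: "'a set set \<Rightarrow> 'c set \<Rightarrow> ('a set \<Rightarrow> 'c) \<Rightarrow> bool" where
  "proper_edge_coloring E C f \<longleftrightarrow>
     (\<forall>e\<in>E. f e \<in> C) \<and> (\<forall>e\<in>E. \<forall>e'\<in>E. e \<noteq> e' \<and> e \<inter> e' \<noteq> {} \<longrightarrow> f e \<noteq> f e')"

lemma simple_graph_cycle_graph:
  assumes "n \<ge> 2"
  shows "simple_graph (cycle_graph n)"
proof -
  have "i \<noteq> Suc i mod n \<and> Suc i mod n < n" if "i < n" for i
    using that assms by (cases "Suc i = n") auto
  then show ?thesis
    by (auto simp: simple_graph_def cycle_graph_def card_2_iff)
qed

lemma verts_cart_power:
  "verts (cart_power G d) = {xs. length xs = d \<and> set xs \<subseteq> verts G}"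
proof (induction d)
  case 0
  then show ?case by auto
next
  case (Suc d)
  then show ?case
    by (auto simp: map_graph_def cart_prod_def length_Suc_conv image_iff)
qed

lemma edges_cart_power_Suc:
  "{x # xs, y # ys} \<in> edges (cart_power G (Suc d)) \<longleftrightarrow>
     x \<in> verts G \<and> y \<in> verts G \<and> xs \<in> verts (cart_power G d) \<and> ys \<in> verts (cart_power G d) \<and>
     (x = y \<and> {xs, ys} \<in> edges (cart_power G d) \<or> {x, y} \<in> edges G \<and> xs = ys)"
  (is "?L \<longleftrightarrow> ?R")
proof
  assume ?L
  then obtain u v u' v' where
    "{x # xs, y # ys} = {u # v, u' # v'}"
    "u \<in> verts G" "v \<in> verts (cart_power G d)" "u' \<in> verts G" "v' \<in> verts (cart_power G d)"
    "u = u' \<and> {v, v'} \<in> edges (cart_power G d) \<or> {u, u'} \<in> edges G \<and> v = v'"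
    by (auto simp: map_graph_def cart_prod_def)
  then show ?R
    by (auto simp: doubleton_eq_iff insert_commute)
next
  assume ?R
  then have "{(x, xs), (y, ys)} \<in> edges (cart_prod G (cart_power G d))"
    unfolding cart_prod_def by auto
  then have "(\<lambda>(x, xs). x # xs) ` {(x, xs), (y, ys)} \<in> edges (cart_power G (Suc d))"
    by (simp add: map_graph_def del: image_insert)
  then show ?L by simp
qed

lemma simple_graph_cart_power:
  assumes "simple_graph G"
  shows "simple_graph (cart_power G d)"
proof (induction d)
  case 0
  then show ?case by (simp add: simple_graph_def)
next
  case (Suc d)
  have 1: "x \<noteq> y" if "{x, y} \<in> edges G" for x y
    using assms that by (fastforce simp: simple_graph_def)
  have 2: "xs \<noteq> ys" if "{xs, ys} \<in> edges (cart_power G d)" for xs ys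
    using Suc that by (fastforce simp: simple_graph_def)
  show ?case
    using 1 2 by (fastforce simp: simple_graph_def map_graph_def cart_prod_def card_2_iff)
qed

end

theory Submission
  imports Defs
begin

text \<open>
  The proof is by induction on \<open>d\<close>, for an arbitrary set of \<open>2d\<close> colours. The edges of \<open>C\<^sub>n\<^sup>d\<close>
  split into \<open>d\<close> directions, so fewer than \<open>2d\<close> precoloured edges leave a direction that
  contains at most one of them. Along that direction the graph consists of \<open>n\<close> cyclically
  arranged copies (layers) of the power \<open>H\<close> with one factor less, and consecutive layers are
  joined by vertical edges. Put \<open>t = 2(d - 1)\<close>. If the vertical edges at the vertices of a layer
  all use the same two colours, then the induction hypothesis colours the layer with the other
  \<open>t\<close> colours, provided that fewer than \<open>t\<close> of its edges are precoloured and none of them in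
  these two colours. There are two ways to get into this situation.

  \<^item> Each gap between consecutive layers gets a single colour that is absent from the two layers
    next to it, and consecutive gaps get different colours. This is a list colouring of a cycle.
    With at most \<open>t + 1\<close> precoloured edges and \<open>t + 2\<close> colours, the lists are usually long
    enough (\<open>cycle_list_coloring\<close>, \<open>extend_uniform\<close>).
  \<^item> Only two colours \<open>c\<close> and \<open>a\<close> are used vertically, in alternate gaps. The precoloured edges
    with these colours are ignored when the layers are coloured, and produced afterwards: if a
    layer edge and its copy in the next layer have the same colour, then they form a 4-cycle
    with two vertical edges, and its two colours can be exchanged (\<open>swap_squares\<close>). The copy has
    the right colour if the partner layer is coloured like the given one, which can be achieved
    if no edge of the partner is precoloured (\<open>extend_alternating\<close>, \<open>extend_paired\<close>). Ignored
    edges do not count, so this deals with a layer that contains \<open>t\<close> or \<open>t + 1\<close> precoloured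
    edges.

  Without a precoloured vertical edge these two methods suffice (\<open>extend_layers\<close>). A precoloured
  vertical edge \<open>h\<close> of colour \<open>c\<close> causes trouble only if \<open>c\<close> occurs in one of the two layers
  that \<open>h\<close> joins (\<open>extend_layers_vertical\<close>). If these layers contain all other precoloured
  edges, then the vertical colours \<open>c\<close> and \<open>a\<close> alternate with \<open>a\<close> in the gap of \<open>h\<close>, except on
  the vertical cycle through \<open>h\<close>, where they are interchanged. If one of the two layers contains
  at least \<open>t - 1\<close> precoloured edges and a third layer contains another one, then the second of
  the two is free, and \<open>c\<close> can be put into the gap of \<open>h\<close>. Otherwise fewer than \<open>t\<close> precoloured
  edges lie in the two layers. As \<open>H\<close> has minimum degree \<open>t\<close> and no triangles, some vertical
  edge next to \<open>h\<close> has no precoloured layer edge at its ends; both layer edges between it and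
  \<open>h\<close> are given the colour \<open>c\<close>, and an exchange on this 4-cycle moves \<open>c\<close> to \<open>h\<close>.
\<close>

section \<open>Choosing colours around a cycle\<close>

text \<open>
  Layers and gaps have the same indices: gap \<open>j\<close> lies between the layers \<open>j\<close> and \<open>nxt n j\<close>, so
  layer \<open>j\<close> lies between the gaps \<open>prv n j\<close> and \<open>j\<close>.
\<close>

definition nxt :: "nat \<Rightarrow> nat \<Rightarrow> nat" where
  "nxt n j = Suc j mod n"

definition prv :: "nat \<Rightarrow> nat \<Rightarrow> nat" where
  "prv n j = (if j = 0 then n - 1 else j - 1)"

lemma nxt_if: "j < n \<Longrightarrow> nxt n j = (if Suc j = n then 0 else Suc j)"
  by (auto simp: nxt_def)

lemma nxt_less: "j < n \<Longrightarrow> nxt n j < n"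
  by (auto simp: nxt_if)

lemma prv_less: "j < n \<Longrightarrow> prv n j < n"
  by (auto simp: prv_def)

lemma nxt_prv: "j < n \<Longrightarrow> nxt n (prv n j) = j"
  by (auto simp: nxt_if prv_def)

lemma prv_nxt: "j < n \<Longrightarrow> prv n (nxt n j) = j"
  by (auto simp: nxt_if prv_def)

lemma ex_outside:
  assumes "finite B" "card B < card S"
  shows "\<exists>y\<in>S. y \<notin> B"
  using assms by (meson card_mono leD subsetI)

lemma path_list_coloring:
  assumes "L 0 \<noteq> {}" "\<And>r. 0 < r \<Longrightarrow> r \<le> q \<Longrightarrow> 2 \<le> card (L r)"
  shows "\<exists>m. (\<forall>r\<le>q. m r \<in> L r) \<and> (\<forall>r<q. m r \<noteq> m (Suc r))"
  using assms(2)
proof (induction q)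
  case 0
  then show ?case using assms(1) by (intro exI[of _ "\<lambda>_. SOME x. x \<in> L 0"]) (auto simp: some_in_eq)
next
  case (Suc q)
  then obtain m where m: "\<forall>r\<le>q. m r \<in> L r" "\<forall>r<q. m r \<noteq> m (Suc r)"
    by (metis le_SucI)
  have "card {m q} < card (L (Suc q))"
    using Suc.prems[of "Suc q"] by simp
  then obtain y where y: "y \<in> L (Suc q)" "y \<noteq> m q"
    using ex_outside[of "{m q}" "L (Suc q)"] by auto
  show ?case
    by (rule exI[of _ "m(Suc q := y)"]) (use m y in \<open>auto simp: le_Suc_eq less_Suc_eq\<close>)
qed

text \<open>
  A greedy choice works if it starts at the position after \<open>i\<close> and runs once around the cycle:
  each later colour has to avoid only its predecessor, except that the last one, at \<open>i\<close>, has to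
  avoid two colours. So one list of size three pays for one list that may be a singleton.
\<close>

lemma cycle_list_coloring:
  assumes "2 \<le> n" "i < n" "3 \<le> card (L i)" "L (nxt n i) \<noteq> {}"
    and "\<And>j. j < n \<Longrightarrow> j \<noteq> nxt n i \<Longrightarrow> 2 \<le> card (L j)"
  shows "\<exists>m. \<forall>j<n. m j \<in> L j \<and> m j \<noteq> m (nxt n j)"
proof -
  define pos where "pos r = (Suc i + r) mod n" for r
  \<comment> \<open>\<open>pos r\<close> is the position visited at time \<open>r\<close>, and \<open>ind\<close> is its inverse.\<close>
  define ind where "ind j = (if i < j then j - Suc i else j + n - Suc i)" for j
  have ind: "ind j < n" "pos (ind j) = j" if "j < n" for j
    using that assms(2) by (auto simp: ind_def pos_def)
  have ind_nxt: "ind (nxt n j) = nxt n (ind j)" if "j < n" for j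
    using that assms(2) ind(1)[OF that] by (auto simp: nxt_if ind_def)
  have pos_inj: "pos r \<noteq> nxt n i" if "0 < r" "r < n" for r
  proof
    assume "pos r = nxt n i"
    then have "(Suc i + r) mod n = (Suc i + 0) mod n" by (simp add: pos_def nxt_def)
    then have "n dvd r" by (metis add_diff_cancel_left' le_add1 mod_eq_dvd_iff_nat add_0_right)
    then show False using that by (simp add: nat_dvd_not_less)
  qed
  have "\<exists>m. (\<forall>r\<le>n - 2. m r \<in> L (pos r)) \<and> (\<forall>r<n - 2. m r \<noteq> m (Suc r))"
  proof (rule path_list_coloring)
    show "L (pos 0) \<noteq> {}" using assms(4) by (simp add: pos_def nxt_def)
    show "2 \<le> card (L (pos r))" if "0 < r" "r \<le> n - 2" for r
      using assms(1) that by (intro assms(5) pos_inj) (auto simp: pos_def)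
  qed
  then obtain m where m: "\<forall>r\<le>n - 2. m r \<in> L (pos r)" "\<forall>r<n - 2. m r \<noteq> m (Suc r)"
    by blast
  have last: "pos (n - 1) = i" using assms(1,2) by (simp add: pos_def)
  have "card {m (n - 2), m 0} < card (L i)"
    using assms(3) card_insert_le_m1[of 2 "{m 0}" "m (n - 2)"] by simp
  then obtain y where y: "y \<in> L i" "y \<noteq> m (n - 2)" "y \<noteq> m 0"
    using ex_outside[of "{m (n - 2), m 0}" "L i"] by auto
  define m' where "m' = m(n - 1 := y)"
  have in_L: "m' r \<in> L (pos r)" if "r < n" for r
    using that m(1) y last by (cases "r = n - 1") (auto simp: m'_def)
  have neq: "m' r \<noteq> m' (nxt n r)" if "r < n" for r
  proof -
    have "r = n - 1 \<or> r = n - 2 \<and> r \<noteq> n - 1 \<or> r < n - 2" using that by arith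
    then consider "r = n - 1" | "r = n - 2" "r \<noteq> n - 1" | "r < n - 2" by blast
    then show ?thesis
    proof cases
      case 1
      then show ?thesis using y(3) assms(1) by (simp add: m'_def nxt_if)
    next
      case 2
      then have "nxt n r = n - 1" using assms(1) by (auto simp: nxt_if)
      then show ?thesis using 2 y(2) by (auto simp: m'_def)
    next
      case 3
      then have "nxt n r = Suc r" "Suc r \<noteq> n - 1" by (auto simp: nxt_if)
      then show ?thesis using 3 m(2) by (auto simp: m'_def)
    qed
  qed
  show ?thesis
    by (rule exI[of _ "\<lambda>j. m' (ind j)"]) (metis ind in_L neq ind_nxt)
qed

text \<open>
  The short list may also precede the long one, because the cycle can be traversed backwards.
\<close>

lemma cycle_list_coloring_rev:
  assumes "2 \<le> n" "i < n" "3 \<le> card (L i)" "L (prv n i) \<noteq> {}"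
    and "\<And>j. j < n \<Longrightarrow> j \<noteq> prv n i \<Longrightarrow> 2 \<le> card (L j)"
  shows "\<exists>m. \<forall>j<n. m j \<in> L j \<and> m j \<noteq> m (nxt n j)"
proof -
  define \<rho> where "\<rho> j = n - Suc j" for j
  have \<rho>: "\<rho> j < n" "\<rho> (\<rho> j) = j" if "j < n" for j using that by (auto simp: \<rho>_def)
  have \<rho>_nxt: "nxt n (\<rho> (nxt n j)) = \<rho> j" if "j < n" for j
    using that by (auto simp: \<rho>_def nxt_if)
  have \<rho>_prv: "\<rho> (nxt n (\<rho> i)) = prv n i"
    using assms(2) by (auto simp: \<rho>_def nxt_if prv_def)
  have "\<exists>m. \<forall>j<n. m j \<in> L (\<rho> j) \<and> m j \<noteq> m (nxt n j)"
    by (rule cycle_list_coloring[of _ "\<rho> i"]) (use assms \<rho> \<rho>_prv nxt_less in \<open>auto, metis\<close>)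
  then obtain m where "\<forall>j<n. m j \<in> L (\<rho> j) \<and> m j \<noteq> m (nxt n j)" by blast
  then show ?thesis
    by (intro exI[of _ "\<lambda>j. m (\<rho> j)"]) (metis \<rho> \<rho>_nxt nxt_less)
qed

section \<open>Colourings of a product, layer by layer\<close>

text \<open>
  The parity \<open>\<epsilon>\<close> selects which half of the gaps gets the first colour.
\<close>

definition alternate :: "bool \<Rightarrow> 'c \<Rightarrow> 'c \<Rightarrow> nat \<Rightarrow> 'c" where
  "alternate \<epsilon> c a j = (if even j = \<epsilon> then c else a)"

text \<open>
  The graph \<open>(V, E)\<close> is the factor \<open>H\<close>, and \<open>extension\<close> is the induction hypothesis for it. The
  palette \<open>P\<close> there is arbitrary because different layers leave different colours to their
  edges.
\<close>

locale layers =
  fixes V :: "'b set" and E :: "'b set set" and n t :: nat and K :: "'c set"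
  assumes even_n: "even n" and n_ge: "4 \<le> n"
    and finite_K: "finite K" and card_K: "card K = t + 2"
    and finite_E: "finite E"
    and edge: "e \<in> E \<Longrightarrow> e \<subseteq> V \<and> card e = 2"
    and triangle_free: "{v, w} \<in> E \<Longrightarrow> {v, w'} \<in> E \<Longrightarrow> {w, w'} \<notin> E"
    and min_degree: "v \<in> V \<Longrightarrow> t \<le> card {w. {v, w} \<in> E}"
    and extension: "P \<subseteq> K \<Longrightarrow> card P = t \<Longrightarrow> A \<subseteq> E \<Longrightarrow> proper_edge_coloring A P \<psi> \<Longrightarrow>
      card A < t \<Longrightarrow> \<exists>f. proper_edge_coloring E P f \<and> (\<forall>e\<in>A. f e = \<psi> e)"
begin

text \<open>
  Proper colourings of the product of \<open>C\<^sub>n\<close> and \<open>H\<close> in separate pieces: \<open>F j\<close> colours the copy of \<open>H\<close> in layer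
  \<open>j\<close>, and \<open>M j x\<close> is the colour of the vertical edge over \<open>x\<close> in gap \<open>j\<close>.
\<close>

definition compatible :: "(nat \<Rightarrow> 'b set \<Rightarrow> 'c) \<Rightarrow> (nat \<Rightarrow> 'b \<Rightarrow> 'c) \<Rightarrow> bool" where
  "compatible F M \<longleftrightarrow>
     (\<forall>j<n. proper_edge_coloring E K (F j)) \<and>
     (\<forall>j<n. \<forall>x\<in>V. M j x \<in> K \<and> M j x \<noteq> M (nxt n j) x) \<and>
     (\<forall>j<n. \<forall>e\<in>E. \<forall>x\<in>e. F j e \<noteq> M j x \<and> F (nxt n j) e \<noteq> M j x)"

lemma even_nxt: "j < n \<Longrightarrow> even (nxt n j) \<longleftrightarrow> odd j"
  using even_n by (auto simp: nxt_if)

lemma nxt_neq: "j < n \<Longrightarrow> nxt n j \<noteq> j"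
  using n_ge by (auto simp: nxt_if)

lemma nxt2_neq: "j < n \<Longrightarrow> nxt n (nxt n j) \<noteq> j"
  using n_ge by (auto simp: nxt_if nxt_less)

lemma nxt3_neq: "j < n \<Longrightarrow> nxt n (nxt n (nxt n j)) \<noteq> j"
  using n_ge by (auto simp: nxt_if nxt_less)

lemma alternate_nxt: "j < n \<Longrightarrow> alternate \<epsilon> c a (nxt n j) = alternate (\<not> \<epsilon>) c a j"
  by (auto simp: alternate_def even_nxt)

text \<open>
  For \<open>e \<in> W j\<close>, the two copies of \<open>e\<close> in the layers next to gap \<open>j\<close> and the two vertical edges
  between their ends form a 4-cycle that is coloured alternately with \<open>F j e\<close> and \<open>\<mu> j\<close>. All
  these 4-cycles are pairwise edge-disjoint, since the edges in \<open>W j\<close> form a matching and \<open>W j\<close>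
  is disjoint from \<open>W (nxt n j)\<close>. Exchanging the two colours of a 4-cycle does not change the
  set of colours at any vertex, so all exchanges can be made at once.
\<close>

lemma swap_squares:
  assumes FM: "compatible F M"
    and W: "\<And>j. j < n \<Longrightarrow> W j \<subseteq> E"
    and match: "\<And>j e e'. j < n \<Longrightarrow> e \<in> W j \<Longrightarrow> e' \<in> W j \<Longrightarrow> e \<inter> e' \<noteq> {} \<Longrightarrow> e = e'"
    and disj: "\<And>j. j < n \<Longrightarrow> W j \<inter> W (nxt n j) = {}"
    and agree: "\<And>j e. j < n \<Longrightarrow> e \<in> W j \<Longrightarrow> F j e = F (nxt n j) e"
    and \<mu>: "\<And>j e x. j < n \<Longrightarrow> e \<in> W j \<Longrightarrow> x \<in> e \<Longrightarrow> M j x = \<mu> j"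
  obtains F' M' where "compatible F' M'"
    and "\<And>j e. j < n \<Longrightarrow> e \<in> W j \<Longrightarrow> F' j e = \<mu> j \<and> F' (nxt n j) e = \<mu> j"
    and "\<And>j e. j < n \<Longrightarrow> e \<notin> W j \<Longrightarrow> e \<notin> W (prv n j) \<Longrightarrow> F' j e = F j e"
    and "\<And>j e x. j < n \<Longrightarrow> e \<in> W j \<Longrightarrow> x \<in> e \<Longrightarrow> M' j x = F j e"
    and "\<And>j x. j < n \<Longrightarrow> \<forall>e\<in>W j. x \<notin> e \<Longrightarrow> M' j x = M j x"
proof -
  define F' where "F' j e = (if e \<in> W j then \<mu> j
      else if e \<in> W (prv n j) then \<mu> (prv n j) else F j e)" for j e
  define M' where "M' j x = (if \<exists>e\<in>W j. x \<in> e then F j (THE e. e \<in> W j \<and> x \<in> e) else M j x)"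
    for j x
  have M'_in: "M' j x = F j e" if "j < n" "e \<in> W j" "x \<in> e" for j e x
  proof -
    have "(THE e. e \<in> W j \<and> x \<in> e) = e"
      using match[OF that(1)] that by (intro the_equality) blast+
    then show ?thesis using that by (auto simp: M'_def)
  qed
  have M'_out: "M' j x = M j x" if "\<forall>e\<in>W j. x \<notin> e" for j x
    using that by (auto simp: M'_def)
  have pcol: "F j e \<in> K" "e' \<in> E \<Longrightarrow> e \<noteq> e' \<Longrightarrow> x \<in> e \<Longrightarrow> x \<in> e' \<Longrightarrow> F j e \<noteq> F j e'"
    if "j < n" "e \<in> E" for j e e' x
    using FM that unfolding compatible_def proper_edge_coloring_def by blast+
  have vert: "M j x \<in> K" "M j x \<noteq> M (nxt n j) x" if "j < n" "x \<in> V" for j x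
    using FM that unfolding compatible_def by blast+
  have cross: "F j e \<noteq> M j x" "F (nxt n j) e \<noteq> M j x" if "j < n" "e \<in> E" "x \<in> e" for j e x
    using FM that unfolding compatible_def by blast+
  have \<mu>_K: "\<mu> j \<in> K" if "j < n" "e \<in> W j" for j e
  proof -
    have "e \<in> E" using W that by blast
    then obtain x where "x \<in> e" "x \<in> V" using edge[of e] by (metis card.empty equals0I subsetD zero_neq_numeral)
    then show ?thesis using \<mu>[OF that] vert(1)[OF that(1)] by metis
  qed
  have inV: "x \<in> V" if "e \<in> E" "x \<in> e" for e x using edge that by blast
  have cases_F': "F' j e = M j x \<and> e \<in> W j \<or> F' j e = M (prv n j) x \<and> e \<in> W (prv n j) \<and> e \<notin> W j
      \<or> F' j e = F j e \<and> e \<notin> W j \<and> e \<notin> W (prv n j)" if "j < n" "x \<in> e" for j e x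
    using that \<mu>[of j e x] \<mu>[of "prv n j" e x] prv_less[of j n] by (auto simp: F'_def)
  have vert': "M (prv n j) x \<noteq> M j x" if "j < n" "x \<in> V" for j x
    using vert(2)[of "prv n j" x] nxt_prv[of j n] prv_less[of j n] that by simp
  have cross': "F j e \<noteq> M (prv n j) x" if "j < n" "e \<in> E" "x \<in> e" for j e x
    using cross(2)[of "prv n j" e x] nxt_prv[of j n] prv_less[of j n] that by simp
  have "proper_edge_coloring E K (F' j)" if j: "j < n" for j
    unfolding proper_edge_coloring_def
  proof (intro conjI ballI impI)
    show "F' j e \<in> K" if "e \<in> E" for e
      using j that \<mu>_K[of j e] \<mu>_K[of "prv n j" e] pcol(1)[of j e] prv_less[of j n] by (auto simp: F'_def)
    fix e e' assume e: "e \<in> E" "e' \<in> E" "e \<noteq> e' \<and> e \<inter> e' \<noteq> {}"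
    then obtain x where x: "x \<in> e" "x \<in> e'" by blast
    have "\<not> (e \<in> W j \<and> e' \<in> W j)" "\<not> (e \<in> W (prv n j) \<and> e' \<in> W (prv n j))"
      using match e j prv_less[OF j] by blast+
    then show "F' j e \<noteq> F' j e'"
      using cases_F'[OF j x(1)] cases_F'[OF j x(2)] vert'[OF j inV[OF e(1) x(1)]]
        cross(1)[OF j e(1) x(1)] cross(1)[OF j e(2) x(2)] cross'[OF j e(1) x(1)] cross'[OF j e(2) x(2)]
        pcol(2)[OF j e(1,2) _ x] e(3) by metis
  qed
  moreover have "M' j x \<in> K \<and> M' j x \<noteq> M' (nxt n j) x" if j: "j < n" and x: "x \<in> V" for j x
  proof
    show "M' j x \<in> K"
      by (cases "\<exists>e\<in>W j. x \<in> e") (use M'_in M'_out pcol(1) vert(1) j x W in \<open>auto, blast\<close>)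
    have j': "nxt n j < n" using nxt_less[OF j] .
    consider (both) e e' where "e \<in> W j" "x \<in> e" "e' \<in> W (nxt n j)" "x \<in> e'"
      | (fst) e where "e \<in> W j" "x \<in> e" "\<forall>e\<in>W (nxt n j). x \<notin> e"
      | (snd) e where "\<forall>e\<in>W j. x \<notin> e" "e \<in> W (nxt n j)" "x \<in> e"
      | (none) "\<forall>e\<in>W j. x \<notin> e" "\<forall>e\<in>W (nxt n j). x \<notin> e" by blast
    then show "M' j x \<noteq> M' (nxt n j) x"
    proof cases
      case both
      then have "e \<noteq> e'" using disj[OF j] by blast
      moreover have "e \<in> E" "e' \<in> E" using both W j j' by blast+
      ultimately show ?thesis
        using M'_in[OF j both(1,2)] M'_in[OF j' both(3,4)] agree[OF j both(1)] pcol(2)[OF j'] both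
        by metis
    next
      case fst
      then show ?thesis using M'_in[OF j fst(1,2)] M'_out[OF fst(3)] agree[OF j fst(1)]
          cross(1)[OF j', of e x] W[OF j] by auto
    next
      case snd
      then show ?thesis using M'_in[OF j' snd(2,3)] M'_out[OF snd(1)]
          cross(2)[OF j, of e x] W[OF j'] by auto
    next
      case none
      then show ?thesis using M'_out vert(2)[OF j x] by simp
    qed
  qed
  moreover have "F' j e \<noteq> M' j x \<and> F' (nxt n j) e \<noteq> M' j x"
    if j: "j < n" and e: "e \<in> E" and x: "x \<in> e" for j e x
  proof -
    have j': "nxt n j < n" using nxt_less[OF j] .
    have p: "prv n (nxt n j) = j" using prv_nxt[OF j] .
    have xV: "x \<in> V" using inV[OF e x] .
    show ?thesis
    proof (cases "\<exists>e2\<in>W j. x \<in> e2")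
      case True
      then obtain e2 where e2: "e2 \<in> W j" "x \<in> e2" by blast
      have e2E: "e2 \<in> E" using e2 W j by blast
      note Mv = M'_in[OF j e2] agree[OF j e2(1)]
      show ?thesis
        using cases_F'[OF j x] cases_F'[OF j' x] Mv p e2 cross(1)[OF j e2E e2(2)] cross'[OF j e2E e2(2)]
          cross(1)[OF j' e2E e2(2)] pcol(2)[OF j e e2E _ x e2(2)] pcol(2)[OF j' e e2E _ x e2(2)]
        by metis
    next
      case False
      then have "e \<notin> W j" using x by blast
      moreover have "M' j x = M j x" using M'_out False by blast
      ultimately show ?thesis
        using cases_F'[OF j x] cases_F'[OF j' x] p vert(2)[OF j xV] vert'[OF j xV] cross[OF j e x]
        by metis
    qed
  qed
  ultimately have "compatible F' M'" unfolding compatible_def by blast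
  moreover have "F' j e = \<mu> j \<and> F' (nxt n j) e = \<mu> j" if "j < n" "e \<in> W j" for j e
    using that disj[OF that(1)] prv_nxt[OF that(1)] by (auto simp: F'_def)
  moreover have "F' j e = F j e" if "e \<notin> W j" "e \<notin> W (prv n j)" for j e
    using that by (simp add: F'_def)
  ultimately show ?thesis using that M'_in M'_out by blast
qed

section \<open>Two ways to choose the colours of the vertical edges\<close>

text \<open>
  From here on \<open>A j\<close> is the set of precoloured edges of layer \<open>j\<close>, and \<open>\<psi> j\<close> is their colouring.
\<close>

lemma finite_layer: "A \<subseteq> E \<Longrightarrow> finite A"
  using finite_E finite_subset by blast

text \<open>
  When gap \<open>j\<close> is coloured uniformly with \<open>m j\<close>, the layer \<open>j\<close> still has the \<open>t\<close> colours other
  than \<open>m (prv n j)\<close> and \<open>m j\<close>, and its precoloured edges use only these.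
\<close>

lemma extend_uniform:
  assumes A: "\<And>j. j < n \<Longrightarrow> A j \<subseteq> E"
    and \<psi>: "\<And>j. j < n \<Longrightarrow> proper_edge_coloring (A j) K (\<psi> j)"
    and small: "\<And>j. j < n \<Longrightarrow> card (A j) < t"
    and m: "\<And>j. j < n \<Longrightarrow> m j \<in> K - \<psi> j ` A j - \<psi> (nxt n j) ` A (nxt n j)"
    and m_neq: "\<And>j. j < n \<Longrightarrow> m j \<noteq> m (nxt n j)"
  shows "\<exists>F. compatible F (\<lambda>j x. m j) \<and> (\<forall>j<n. \<forall>e\<in>A j. F j e = \<psi> j e)"
proof -
  have "\<exists>f. proper_edge_coloring E (K - {m (prv n j), m j}) f \<and> (\<forall>e\<in>A j. f e = \<psi> j e)"
    if j: "j < n" for j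
  proof (rule extension)
    have p: "prv n j < n" "nxt n (prv n j) = j" using j by (simp_all add: prv_less nxt_prv)
    have "m (prv n j) \<noteq> m j" "m j \<in> K" "m (prv n j) \<in> K"
      using m_neq[OF p(1)] m[OF j] m[OF p(1)] p(2) by auto
    then show "card (K - {m (prv n j), m j}) = t"
      using card_K finite_K by (simp add: card_Diff_subset)
    have "m j \<notin> \<psi> j ` A j" "m (prv n j) \<notin> \<psi> j ` A j"
      using m[OF j] m[OF p(1)] p(2) by auto
    then show "proper_edge_coloring (A j) (K - {m (prv n j), m j}) (\<psi> j)"
      using \<psi>[OF j] by (force simp: proper_edge_coloring_def)
  qed (use A small j in auto)
  then obtain F where F: "\<And>j. j < n \<Longrightarrow> proper_edge_coloring E (K - {m (prv n j), m j}) (F j)"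
    "\<And>j e. j < n \<Longrightarrow> e \<in> A j \<Longrightarrow> F j e = \<psi> j e" by metis
  have F_in: "F j e \<in> K" "F j e \<noteq> m (prv n j)" "F j e \<noteq> m j" if "j < n" "e \<in> E" for j e
    using F(1)[OF that(1)] that(2) by (auto simp: proper_edge_coloring_def)
  have "compatible F (\<lambda>j x. m j)"
    unfolding compatible_def
  proof (intro conjI allI impI ballI)
    fix j assume j: "j < n"
    show "proper_edge_coloring E K (F j)"
      using F(1)[OF j] by (simp add: proper_edge_coloring_def)
    show "m j \<in> K" using m[OF j] by simp
    show "m j \<noteq> m (nxt n j)" using m_neq[OF j] .
    show "F j e \<noteq> m j" if "e \<in> E" for e using F_in(3)[OF j that] .
    show "F (nxt n j) e \<noteq> m j" if "e \<in> E" for e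
      using F_in(2)[OF nxt_less[OF j] that] by (simp add: prv_nxt j)
  qed
  then show ?thesis using F(2) by blast
qed

text \<open>
  All layers lose the same two colours \<open>c\<close> and \<open>a\<close>, so any layer may copy the colouring of
  another one: layer \<open>j\<close> is coloured in the way required by layer \<open>r j\<close>. A precoloured edge of
  colour \<open>c\<close> or \<open>a\<close> next to a gap of its own colour gets this colour by an exchange through that
  gap, and for this the layers on both sides of the gap must be coloured alike. On the vertical
  cycles over \<open>Fl\<close> the two colours are interchanged; no exchange involves these cycles.
\<close>

lemma extend_alternating:
  assumes A: "\<And>j. j < n \<Longrightarrow> A j \<subseteq> E"
    and \<psi>: "\<And>j. j < n \<Longrightarrow> proper_edge_coloring (A j) K (\<psi> j)"
    and ca: "c \<in> K" "a \<in> K" "c \<noteq> a"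
    and few: "\<And>j. j < n \<Longrightarrow> card {e \<in> A j. \<psi> j e \<notin> {c, a}} < t"
    and r: "\<And>j. j < n \<Longrightarrow> r j < n" "\<And>j. j < n \<Longrightarrow> A j \<noteq> {} \<Longrightarrow> r j = j"
    and rc: "\<And>j i e. j < n \<Longrightarrow> i = j \<or> i = nxt n j \<Longrightarrow> e \<in> A i \<Longrightarrow>
      \<psi> i e = alternate \<epsilon> c a j \<Longrightarrow> r j = r (nxt n j)"
    and Fl: "\<And>j e. j < n \<Longrightarrow> e \<in> A j \<Longrightarrow> \<psi> j e \<in> {c, a} \<Longrightarrow> e \<inter> Fl = {}"
  obtains F M where "compatible F M"
    and "\<And>j e. j < n \<Longrightarrow> e \<in> A j \<Longrightarrow> F j e = \<psi> j e"
    and "\<And>j x. j < n \<Longrightarrow> even j = \<epsilon> \<Longrightarrow> x \<notin> Fl \<Longrightarrow>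
      \<forall>i\<in>{j, nxt n j}. \<forall>e\<in>A i. \<psi> i e = c \<longrightarrow> x \<notin> e \<Longrightarrow> M j x = c"
    and "\<And>j x. j < n \<Longrightarrow> x \<in> Fl \<Longrightarrow> even j \<noteq> \<epsilon> \<Longrightarrow> M j x = c"
proof -
  have "\<exists>f. proper_edge_coloring E (K - {c, a}) f \<and>
      (\<forall>e\<in>{e \<in> A j. \<psi> j e \<notin> {c, a}}. f e = \<psi> j e)" if j: "j < n" for j
  proof (rule extension)
    show "card (K - {c, a}) = t"
      using card_K finite_K ca by (simp add: card_Diff_subset)
    show "proper_edge_coloring {e \<in> A j. \<psi> j e \<notin> {c, a}} (K - {c, a}) (\<psi> j)"
      using \<psi>[OF j] by (auto simp: proper_edge_coloring_def)
  qed (use A few j in auto)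
  then obtain G where G: "\<And>j. j < n \<Longrightarrow> proper_edge_coloring E (K - {c, a}) (G j)"
    "\<And>j e. j < n \<Longrightarrow> e \<in> A j \<Longrightarrow> \<psi> j e \<notin> {c, a} \<Longrightarrow> G j e = \<psi> j e"
    by (metis (mono_tags, lifting) mem_Collect_eq)
  define F where "F j = G (r j)" for j
  define \<mu> where "\<mu> = alternate \<epsilon> c a"
  define M where "M j x = (if x \<in> Fl then alternate (\<not> \<epsilon>) c a j else \<mu> j)" for j and x :: 'b
  define W where "W j = {e. \<exists>i\<in>{j, nxt n j}. e \<in> A i \<and> \<psi> i e = \<mu> j}" for j
  have \<mu>_ca: "\<mu> j \<in> {c, a}" for j by (simp add: \<mu>_def alternate_def)
  have M_ca: "M j x \<in> {c, a}" for j x by (simp add: M_def \<mu>_def alternate_def)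
  have F_ok: "proper_edge_coloring E (K - {c, a}) (F j)" if "j < n" for j
    using G(1) r(1) that by (simp add: F_def)
  have F_in: "F j e \<in> K - {c, a}" if "j < n" "e \<in> E" for j e
    using F_ok that by (simp add: proper_edge_coloring_def)
  have comp: "compatible F M"
    unfolding compatible_def
  proof (intro conjI allI impI ballI)
    fix j assume j: "j < n"
    show "proper_edge_coloring E K (F j)"
      using F_ok[OF j] by (simp add: proper_edge_coloring_def)
    show "M j x \<in> K" for x using M_ca[of j x] ca by auto
    show "M j x \<noteq> M (nxt n j) x" for x
      using j ca by (auto simp: M_def \<mu>_def alternate_nxt) (auto simp: alternate_def split: if_splits)
    show "F j e \<noteq> M j x" "F (nxt n j) e \<noteq> M j x" if "e \<in> E" for e x
      using F_in[OF j that] F_in[OF nxt_less[OF j] that] M_ca[of j x] by auto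
  qed
  have WA: "e \<in> A j \<and> \<psi> j e = \<mu> j \<or> e \<in> A (nxt n j) \<and> \<psi> (nxt n j) e = \<mu> j" if "e \<in> W j" for j e
    using that by (auto simp: W_def)
  have Wr: "r j = r (nxt n j)" if "j < n" "e \<in> W j" for j e
    using WA[OF that(2)] rc[OF that(1)] by (auto simp: \<mu>_def)
  \<comment> \<open>The layers on both sides of a gap used for an exchange copy the same layer, while a layer
    with precoloured edges copies itself. So they cannot both contain precoloured edges. Hence all 4-cycles in a gap come
    from one layer, where edges of equal colour form a matching.\<close>
  have alone: "A j = {} \<or> A (nxt n j) = {}" if "j < n" "e \<in> W j" for j e
    using Wr[OF that] r(2)[of j] r(2)[of "nxt n j"] that(1) nxt_less nxt_neq by metis
  have \<mu>_nxt: "\<mu> (nxt n j) \<noteq> \<mu> j" if "j < n" for j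
    using ca that by (auto simp: \<mu>_def alternate_nxt) (auto simp: alternate_def split: if_splits)
  obtain F' M' where comp': "compatible F' M'"
    and F'_in: "\<And>j e. j < n \<Longrightarrow> e \<in> W j \<Longrightarrow> F' j e = \<mu> j \<and> F' (nxt n j) e = \<mu> j"
    and F'_out: "\<And>j e. j < n \<Longrightarrow> e \<notin> W j \<Longrightarrow> e \<notin> W (prv n j) \<Longrightarrow> F' j e = F j e"
    and M'_in: "\<And>j e x. j < n \<Longrightarrow> e \<in> W j \<Longrightarrow> x \<in> e \<Longrightarrow> M' j x = F j e"
    and M'_out: "\<And>j x. j < n \<Longrightarrow> \<forall>e\<in>W j. x \<notin> e \<Longrightarrow> M' j x = M j x"
  proof (rule swap_squares[OF comp, of W \<mu>])
    fix j assume j: "j < n"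
    show "W j \<subseteq> E" using WA A[OF j] A[OF nxt_less[OF j]] by blast
    show "e = e'" if "e \<in> W j" "e' \<in> W j" "e \<inter> e' \<noteq> {}" for e e'
      using WA[OF that(1)] WA[OF that(2)] alone[OF j that(1)] that(3) \<psi>[OF j] \<psi>[OF nxt_less[OF j]]
      unfolding proper_edge_coloring_def by (metis empty_iff)
    show "F j e = F (nxt n j) e" if "e \<in> W j" for e
      using Wr[OF j that] by (simp add: F_def)
    show "M j x = \<mu> j" if "e \<in> W j" "x \<in> e" for e x
    proof -
      have "x \<notin> Fl"
        using WA[OF that(1)] Fl[OF j] Fl[OF nxt_less[OF j]] \<mu>_ca[of j] that(2) by force
      then show ?thesis by (simp add: M_def)
    qed
    show "W j \<inter> W (nxt n j) = {}"
    proof (rule ccontr)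
      assume "W j \<inter> W (nxt n j) \<noteq> {}"
      then obtain e where e: "e \<in> W j" "e \<in> W (nxt n j)" by blast
      let ?s = "nxt n j" let ?s2 = "nxt n (nxt n j)"
      have s: "?s < n" "?s2 < n" using j nxt_less by auto
      have "r j = r ?s" "r ?s = r ?s2" using Wr[OF j e(1)] Wr[OF s(1) e(2)] .
      then have "\<not> (A j \<noteq> {} \<and> A ?s2 \<noteq> {})"
        using r(2)[OF j] r(2)[OF s(2)] nxt2_neq[OF j] by metis
      then show False
        using WA[OF e(1)] WA[OF e(2)] alone[OF j e(1)] alone[OF s(1) e(2)] \<mu>_nxt[OF j] by fastforce
    qed
  qed (rule that)
  have "F' j e = \<psi> j e" if j: "j < n" and e: "e \<in> A j" for j e
  proof -
    have p: "prv n j < n" "nxt n (prv n j) = j" using j by (simp_all add: prv_less nxt_prv)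
    show ?thesis
    proof (cases "\<psi> j e \<in> {c, a}")
      case True
      then have "\<psi> j e = \<mu> j \<or> \<psi> j e = \<mu> (prv n j)"
        using \<mu>_nxt[OF p(1)] \<mu>_ca[of j] \<mu>_ca[of "prv n j"] p(2) by auto
      then show ?thesis
      proof
        assume *: "\<psi> j e = \<mu> j"
        then have "e \<in> W j" using e by (auto simp: W_def)
        then show ?thesis using F'_in[OF j] * by simp
      next
        assume *: "\<psi> j e = \<mu> (prv n j)"
        then have "e \<in> W (prv n j)" using e p by (auto simp: W_def)
        then show ?thesis using F'_in[OF p(1)] p * by auto
      qed
    next
      case False
      then have "\<psi> j e \<noteq> \<mu> j" "\<psi> j e \<noteq> \<mu> (prv n j)"
        using \<mu>_ca[of j] \<mu>_ca[of "prv n j"] by auto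
      then have "e \<notin> W j" "e \<notin> W (prv n j)"
        using WA[of e j] WA[of e "prv n j"] alone[OF j, of e] alone[OF p(1), of e] e p(2) by auto
      moreover have "r j = j" using r(2)[OF j] e by blast
      ultimately have "F' j e = G j e" using F'_out[OF j] by (simp add: F_def)
      then show ?thesis using G(2)[OF j e] False by simp
    qed
  qed
  moreover have "M' j x = c"
    if "j < n" "even j = \<epsilon>" "x \<notin> Fl" "\<forall>i\<in>{j, nxt n j}. \<forall>e\<in>A i. \<psi> i e = c \<longrightarrow> x \<notin> e" for j x
  proof -
    have "\<mu> j = c" using that(2) by (simp add: \<mu>_def alternate_def)
    then have "\<forall>e\<in>W j. x \<notin> e" using that(4) by (auto simp: W_def)
    then show ?thesis using M'_out[OF that(1)] that(3) \<open>\<mu> j = c\<close> by (simp add: M_def)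
  qed
  moreover have "M' j x = c" if "j < n" "x \<in> Fl" "even j \<noteq> \<epsilon>" for j x
  proof -
    have "x \<notin> e" if "e \<in> W j" for e
      using WA[OF that] Fl[OF \<open>j < n\<close>] Fl[OF nxt_less[OF \<open>j < n\<close>]] \<mu>_ca[of j] \<open>x \<in> Fl\<close> by force
    then show ?thesis using M'_out[OF that(1)] that by (auto simp: M_def alternate_def)
  qed
  ultimately show ?thesis by (rule that[OF comp'])
qed

text \<open>
  If \<open>a\<close> occurs nowhere, exchanges take place only in the gaps of colour \<open>c\<close>, which group the
  layers into pairs. An empty layer then copies its partner.
\<close>

lemma extend_paired:
  assumes A: "\<And>j. j < n \<Longrightarrow> A j \<subseteq> E"
    and \<psi>: "\<And>j. j < n \<Longrightarrow> proper_edge_coloring (A j) K (\<psi> j)"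
    and ca: "c \<in> K" "a \<in> K" "c \<noteq> a"
    and unused: "\<And>j e. j < n \<Longrightarrow> e \<in> A j \<Longrightarrow> \<psi> j e \<noteq> a"
    and few: "\<And>j. j < n \<Longrightarrow> card {e \<in> A j. \<psi> j e \<noteq> c} < t"
    and pairs: "\<And>j. j < n \<Longrightarrow> even j = \<epsilon> \<Longrightarrow> A j = {} \<or> A (nxt n j) = {}"
    and Fl: "\<And>j e. j < n \<Longrightarrow> e \<in> A j \<Longrightarrow> \<psi> j e = c \<Longrightarrow> e \<inter> Fl = {}"
  obtains F M where "compatible F M"
    and "\<And>j e. j < n \<Longrightarrow> e \<in> A j \<Longrightarrow> F j e = \<psi> j e"
    and "\<And>j x. j < n \<Longrightarrow> even j = \<epsilon> \<Longrightarrow> x \<notin> Fl \<Longrightarrow>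
      \<forall>i\<in>{j, nxt n j}. \<forall>e\<in>A i. \<psi> i e = c \<longrightarrow> x \<notin> e \<Longrightarrow> M j x = c"
    and "\<And>j x. j < n \<Longrightarrow> x \<in> Fl \<Longrightarrow> even j \<noteq> \<epsilon> \<Longrightarrow> M j x = c"
proof -
  define r where "r j = (if A j \<noteq> {} then j else if even j = \<epsilon> then nxt n j else prv n j)" for j
  show ?thesis
  proof (rule extend_alternating[where A = A and \<psi> = \<psi> and c = c and a = a and
      \<epsilon> = \<epsilon> and r = r and Fl = Fl])
    show "card {e \<in> A j. \<psi> j e \<notin> {c, a}} < t" if "j < n" for j
    proof -
      have "{e \<in> A j. \<psi> j e \<notin> {c, a}} = {e \<in> A j. \<psi> j e \<noteq> c}" using unused[OF that] by auto
      then show ?thesis using few[OF that] by simp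
    qed
    show "r j < n" if "j < n" for j using that by (simp add: r_def nxt_less prv_less)
    show "r j = j" if "A j \<noteq> {}" for j using that by (simp add: r_def)
    show "r j = r (nxt n j)"
      if j: "j < n" and i: "i = j \<or> i = nxt n j" and e: "e \<in> A i" "\<psi> i e = alternate \<epsilon> c a j" for j i e
    proof -
      have "i < n" using i j nxt_less by auto
      then have "even j = \<epsilon>" using e unused[of i e] by (auto simp: alternate_def split: if_splits)
      then show ?thesis
        using i e(1) pairs[OF j] even_nxt[OF j] prv_nxt[OF j] by (auto simp: r_def)
    qed
    show "e \<inter> Fl = {}" if "j < n" "e \<in> A j" "\<psi> j e \<in> {c, a}" for j e
      using Fl[OF that(1,2)] unused[OF that(1,2)] that(3) by blast
  qed (fact A \<psi> ca | rule that)+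
qed

section \<open>Extending a precolouring of all layers\<close>

lemma free_colors:
  assumes "finite B" "finite C"
  shows "t + 2 \<le> card (K - f ` B - g ` C) + (card B + card C)"
proof -
  have "card K \<le> card (K - (f ` B \<union> g ` C)) + card (f ` B \<union> g ` C)"
    using diff_card_le_card_Diff[of "f ` B \<union> g ` C" K] assms by simp
  also have "card (f ` B \<union> g ` C) \<le> card B + card C"
    by (meson add_mono assms card_Un_le card_image_le le_trans)
  finally show ?thesis by (simp add: card_K Diff_Diff_Int set_diff_eq Un_def conj_assoc)
qed

lemma unused_color:
  assumes A: "\<And>j. j < n \<Longrightarrow> A j \<subseteq> E" and "finite B" "(\<Sum>j<n. card (A j)) + card B < t + 2"
  shows "\<exists>a\<in>K. a \<notin> B \<and> (\<forall>j<n. \<forall>e\<in>A j. \<psi> j e \<noteq> a)"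
proof -
  have fin: "finite (A j)" if "j < n" for j using A[OF that] finite_layer by blast
  have "card ((\<Union>j<n. \<psi> j ` A j) \<union> B) \<le> card (\<Union>j<n. \<psi> j ` A j) + card B"
    by (rule card_Un_le)
  also have "card (\<Union>j<n. \<psi> j ` A j) \<le> (\<Sum>j<n. card (\<psi> j ` A j))"
    by (rule card_UN_le) simp
  also have "\<dots> \<le> (\<Sum>j<n. card (A j))"
    by (rule sum_mono) (use fin in \<open>simp add: card_image_le\<close>)
  finally have "card ((\<Union>j<n. \<psi> j ` A j) \<union> B) < card K" using assms(3) card_K by simp
  moreover have "finite ((\<Union>j<n. \<psi> j ` A j) \<union> B)" using fin assms(2) by simp
  ultimately obtain a where "a \<in> K" "a \<notin> (\<Union>j<n. \<psi> j ` A j) \<union> B" using ex_outside by blast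
  then show ?thesis by auto
qed

lemma sum_layers:
  fixes N :: "nat \<Rightarrow> nat"
  assumes "J \<subseteq> {..<n}" "(\<Sum>j<n. N j) \<le> s"
  shows "(\<Sum>j\<in>J. N j) \<le> s"
  using sum_mono2[OF finite_lessThan assms(1), of N] assms(2) by simp

text \<open>
  If every layer has fewer than \<open>t\<close> precoloured edges, uniform gaps suffice. The list of gap \<open>j\<close>
  consists of the colours that are absent from the layers \<open>j\<close> and \<open>nxt n j\<close>; it has one element
  at worst, and that happens only if these two layers contain all \<open>t + 1\<close> precoloured edges.

  If some layer \<open>l\<close> has at least \<open>t\<close> precoloured edges, at most one lies elsewhere. If there is
  one, in layer \<open>g\<close> say, then the alternating colouring ignores the edges of one colour in \<open>l\<close>,
  and the parity is chosen such that \<open>l\<close> is not paired with \<open>g\<close>. If there is none, the vertical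
  colours are chosen such that at least two edges of \<open>l\<close> are ignored, which leaves at most
  \<open>t - 1\<close> edges, and all layers copy \<open>l\<close>.
\<close>

lemma extend_layers:
  assumes t_ge: "2 \<le> t"
    and A: "\<And>j. j < n \<Longrightarrow> A j \<subseteq> E"
    and \<psi>: "\<And>j. j < n \<Longrightarrow> proper_edge_coloring (A j) K (\<psi> j)"
    and total: "(\<Sum>j<n. card (A j)) \<le> t + 1"
  shows "\<exists>F M. compatible F M \<and> (\<forall>j<n. \<forall>e\<in>A j. F j e = \<psi> j e)"
proof -
  have fin: "finite (A j)" if "j < n" for j using A[OF that] finite_layer by blast
  have K: "\<psi> j e \<in> K" if "j < n" "e \<in> A j" for j e
    using \<psi>[OF that(1)] that(2) by (simp add: proper_edge_coloring_def)
  define N where "N j = card (A j)" for j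
  have sum_le: "(\<Sum>j\<in>J. N j) \<le> t + 1" if "J \<subseteq> {..<n}" for J
    using sum_layers[OF that] total by (simp add: N_def)
  have pair: "N j + N l \<le> t + 1" if "j < n" "l < n" "j \<noteq> l" for j l
    using sum_le[of "{j, l}"] that by simp
  have triple: "N i + N j + N l \<le> t + 1" if "i < n" "j < n" "l < n" "i \<noteq> j" "j \<noteq> l" "i \<noteq> l" for i j l
    using sum_le[of "{i, j, l}"] that by simp
  have empty: "A j = {}" if "j < n" "N j = 0" for j using that fin by (simp add: N_def)
  show ?thesis
  proof (cases "\<forall>j<n. N j < t")
    case small: True
    \<comment> \<open>The greedy choice needs a list of size three right before the only list that may be a singleton.\<close>
    have "\<exists>i<n. N i + N (nxt n i) < t \<and> (\<forall>l<n. l \<noteq> nxt n i \<longrightarrow> N l + N (nxt n l) \<le> t)"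
    proof (cases "\<exists>j<n. N j + N (nxt n j) = t + 1")
      case True
      then obtain j where j: "j < n" "N j + N (nxt n j) = t + 1" by blast
      have zero: "N l = 0" if "l < n" "l \<noteq> j" "l \<noteq> nxt n j" for l
        using triple[OF that(1) j(1) nxt_less[OF j(1)]] that j nxt_neq[OF j(1)] by simp
      have le: "N l + N (nxt n l) < t" if "l < n" "l \<noteq> j" for l
      proof (cases "l = nxt n j")
        case True
        then have "N (nxt n l) = 0"
          using zero[of "nxt n l"] nxt2_neq[OF j(1)] nxt_neq[OF that(1)] nxt_less[OF that(1)] by simp
        then show ?thesis using small that(1) by simp
      next
        case False
        then show ?thesis using zero[OF that] small nxt_less[OF that(1)] by simp
      qed
      \<comment> \<open>Gap \<open>j\<close> may have a singleton list; the gap before it has a long one, since layer \<open>prv n j\<close> is empty.\<close>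
      have "prv n j < n" "prv n j \<noteq> j" "nxt n (prv n j) = j"
        using prv_less[OF j(1)] nxt_prv[OF j(1)] nxt_neq[OF j(1)] by metis+
      then show ?thesis using le by (metis less_imp_le)
    next
      case False
      then have le: "N l + N (nxt n l) \<le> t" if "l < n" for l
        using pair[OF that nxt_less[OF that]] nxt_neq[OF that] that by (metis Suc_eq_plus1 le_SucE)
      \<comment> \<open>Two disjoint pairs of layers cannot both contain \<open>t\<close> of at most \<open>t + 1\<close> edges.\<close>
      have "N 0 + N 1 + N 2 + N 3 \<le> t + 1"
        using sum_le[of "{0, 1, 2, 3}"] n_ge by simp
      moreover have "nxt n 0 = 1" "nxt n 2 = 3" using n_ge by (auto simp: nxt_if)
      ultimately have "N 0 + N (nxt n 0) < t \<or> N 2 + N (nxt n 2) < t"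
        using t_ge by simp linarith
      moreover have "0 < n" "2 < n" using n_ge by simp_all
      ultimately show ?thesis using le by blast
    qed
    then obtain i where i: "i < n" "N i + N (nxt n i) < t"
      "\<And>l. l < n \<Longrightarrow> l \<noteq> nxt n i \<Longrightarrow> N l + N (nxt n l) \<le> t" by blast
    define L where "L j = K - \<psi> j ` A j - \<psi> (nxt n j) ` A (nxt n j)" for j
    have L: "t + 2 \<le> card (L j) + (N j + N (nxt n j))" if "j < n" for j
      using free_colors[OF fin[OF that] fin[OF nxt_less[OF that]]] by (simp add: L_def N_def)
    have "\<exists>m. \<forall>j<n. m j \<in> L j \<and> m j \<noteq> m (nxt n j)"
    proof (rule cycle_list_coloring[OF _ i(1)])
      show "2 \<le> n" using n_ge by simp
      show "3 \<le> card (L i)" using L[OF i(1)] i(2) by simp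
      have i': "nxt n i < n" using i(1) nxt_less by blast
      have "0 < card (L (nxt n i))"
        using L[OF i'] pair[OF i' nxt_less[OF i']] nxt_neq[OF i'] by simp
      then show "L (nxt n i) \<noteq> {}" by auto
      show "2 \<le> card (L j)" if "j < n" "j \<noteq> nxt n i" for j
        using L[OF that(1)] i(3)[OF that] by simp
    qed
    then obtain m where "\<And>j. j < n \<Longrightarrow> m j \<in> L j \<and> m j \<noteq> m (nxt n j)" by blast
    then have "\<exists>F. compatible F (\<lambda>j x. m j) \<and> (\<forall>j<n. \<forall>e\<in>A j. F j e = \<psi> j e)"
      by (intro extend_uniform[OF A \<psi>]) (use small in \<open>auto simp: L_def N_def\<close>)
    then show ?thesis by blast
  next
    case False
    then obtain l where l: "l < n" "t \<le> N l" by (meson not_le)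
    then have "A l \<noteq> {}" using t_ge by (auto simp: N_def)
    then obtain e1 where e1: "e1 \<in> A l" by blast
    define c where "c = \<psi> l e1"
    have c: "c \<in> K" using K[OF l(1) e1] by (simp add: c_def)
    show ?thesis
    proof (cases "\<exists>g<n. g \<noteq> l \<and> A g \<noteq> {}")
      case True
      then obtain g where g: "g < n" "g \<noteq> l" "A g \<noteq> {}" by blast
      then have "N g \<noteq> 0" using empty by blast
      then have Ng: "N g = 1" "N l = t" using pair[OF g(1) l(1) g(2)] l(2) by simp_all
      have zero: "A j = {}" if "j < n" "j \<noteq> g" "j \<noteq> l" for j
        using triple[OF that(1) g(1) l(1) that(2) g(2) that(3)] Ng empty[OF that(1)] by simp
      have "\<exists>a\<in>K. a \<notin> {} \<and> (\<forall>j<n. \<forall>e\<in>A j. \<psi> j e \<noteq> a)"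
        by (rule unused_color) (use A total in simp_all)
      then obtain a where a: "a \<in> K" "\<And>j e. j < n \<Longrightarrow> e \<in> A j \<Longrightarrow> \<psi> j e \<noteq> a"
        by blast
      define \<epsilon> where "\<epsilon> = (if g = nxt n l then odd l else even l)"
      show ?thesis
      proof (rule extend_paired[where A = A and \<psi> = \<psi> and c = c and a = a and
          \<epsilon> = \<epsilon> and Fl = "{}"])
        show ?thesis if "compatible F M" "\<And>j e. j < n \<Longrightarrow> e \<in> A j \<Longrightarrow> F j e = \<psi> j e" for F M
          using that by blast
        show "c \<noteq> a" using a(2)[OF l(1) e1] by (simp add: c_def)
        show "card {e \<in> A j. \<psi> j e \<noteq> c} < t" if j: "j < n" for j
        proof (cases "j = l")
          case True
          have "card {e \<in> A j. \<psi> j e \<noteq> c} < card (A l)"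
            by (rule psubset_card_mono) (use fin l e1 True in \<open>auto simp: c_def\<close>)
          then show ?thesis using Ng by (simp add: N_def)
        next
          case False
          have "card {e \<in> A j. \<psi> j e \<noteq> c} \<le> N j"
            unfolding N_def by (rule card_mono) (use fin j in auto)
          also have "N j < t" using zero[OF j _ False] Ng t_ge by (cases "j = g") (auto simp: N_def)
          finally show ?thesis .
        qed
        show "A j = {} \<or> A (nxt n j) = {}" if j: "j < n" "even j = \<epsilon>" for j
        proof (rule ccontr)
          assume ne: "\<not> (A j = {} \<or> A (nxt n j) = {})"
          then have "j = g \<or> j = l" "nxt n j = g \<or> nxt n j = l"
            using zero[of j] zero[of "nxt n j"] j(1) nxt_less by blast+
          then have "j = g \<and> nxt n j = l \<or> j = l \<and> nxt n j = g" using nxt_neq[OF j(1)] by metis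
          then show False
            using j even_nxt[OF j(1)] nxt2_neq[OF j(1)] by (auto simp: \<epsilon>_def split: if_splits)
        qed
      qed (fact A \<psi> c a | simp)+
    next
      case False
      have "card {e1} < card (A l)" using l t_ge by (simp add: N_def)
      then obtain e2 where e2: "e2 \<in> A l" "e2 \<noteq> e1" using ex_outside[of "{e1}" "A l"] by auto
      have "card {c} < card K" using card_K by simp
      then obtain a' where a': "a' \<in> K" "a' \<noteq> c" using ex_outside[of "{c}" K] by auto
      define a where "a = (if \<psi> l e2 = c then a' else \<psi> l e2)"
      have a: "a \<in> K" "c \<noteq> a" "\<psi> l e2 \<in> {c, a}" using a' K[OF l(1) e2(1)] by (auto simp: a_def)
      have "N l \<le> t + 1" using sum_le[of "{l}"] l by simp
      show ?thesis
      proof (rule extend_alternating[where A = A and \<psi> = \<psi> and c = c and a = a and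
          \<epsilon> = True and r = "\<lambda>_. l" and Fl = "{}"])
        show ?thesis if "compatible F M" "\<And>j e. j < n \<Longrightarrow> e \<in> A j \<Longrightarrow> F j e = \<psi> j e" for F M
          using that by blast
        show "card {e \<in> A j. \<psi> j e \<notin> {c, a}} < t" if j: "j < n" for j
        proof (cases "j = l")
          case True
          have "card {e \<in> A j. \<psi> j e \<notin> {c, a}} \<le> card (A l - {e1, e2})"
            by (rule card_mono) (use fin l a(3) True in \<open>auto simp: c_def\<close>)
          also have "\<dots> = N l - 2" using e1 e2 fin[OF l(1)] by (simp add: card_Diff_subset N_def)
          finally show ?thesis using \<open>N l \<le> t + 1\<close> l t_ge by simp
        next
          case False
          then have "A j = {}" using \<open>\<not> (\<exists>g<n. g \<noteq> l \<and> A g \<noteq> {})\<close> j by blast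
          then show ?thesis using t_ge by simp
        qed
        show "l = j" if "j < n" "A j \<noteq> {}" for j using False that by blast
      qed (fact A \<psi> c a | simp add: l)+
    qed
  qed
qed

text \<open>
  The vertical edge over \<open>v\<close> in gap \<open>h\<close> has the prescribed colour \<open>c\<close>. The cases are as follows.

  \<^item> \<open>heavy\<close>: one layer contains all \<open>t\<close> precoloured edges, and the other layers copy it. With
    \<open>c\<close> in gap \<open>h\<close> the vertical edge is right, and it takes part in no exchange, since edges of
    colour \<open>c\<close> next to gap \<open>h\<close> avoid \<open>v\<close>.
  \<^item> \<open>absent\<close>: uniform gaps, where the list of gap \<open>h\<close> is just \<open>{c}\<close>.
  \<^item> \<open>confined\<close>: with \<open>a\<close> in gap \<open>h\<close> and \<open>c\<close> in the gaps before and after it, each of the two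
    layers next to gap \<open>h\<close> is paired with an empty one. Interchanging \<open>c\<close> and \<open>a\<close> on the
    vertical cycle over \<open>v\<close> gives \<open>c\<close> to the vertical edge.
  \<^item> \<open>one_sided\<close>: with \<open>c\<close> in gap \<open>h\<close>, the layers \<open>h\<close> and \<open>nxt n h\<close> are partners, and one of them
    is empty.
  \<^item> \<open>spread\<close>: both layers next to gap \<open>h\<close> have room for one more precoloured edge. Some
    neighbour \<open>w\<close> of \<open>v\<close> is untouched by their precoloured edges; the edge \<open>{v, w}\<close> is
    precoloured \<open>c\<close> in both layers, uniform gaps are used, and finally the exchange on the
    4-cycle over \<open>{v, w}\<close> brings \<open>c\<close> to the vertical edge over \<open>v\<close>.
\<close>

lemma extend_layers_vertical:
  assumes t_ge: "2 \<le> t"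
    and A: "\<And>j. j < n \<Longrightarrow> A j \<subseteq> E"
    and \<psi>: "\<And>j. j < n \<Longrightarrow> proper_edge_coloring (A j) K (\<psi> j)"
    and total: "(\<Sum>j<n. card (A j)) \<le> t"
    and h: "h < n" "v \<in> V" "c \<in> K"
    and v: "\<And>i e. i \<in> {h, nxt n h} \<Longrightarrow> e \<in> A i \<Longrightarrow> v \<in> e \<Longrightarrow> \<psi> i e \<noteq> c"
  shows "\<exists>F M. compatible F M \<and> (\<forall>j<n. \<forall>e\<in>A j. F j e = \<psi> j e) \<and> M h v = c"
proof -
  let ?h' = "nxt n h"
  have h': "?h' < n" using nxt_less[OF h(1)] .
  have fin: "finite (A j)" if "j < n" for j using A[OF that] finite_layer by blast
  have K: "\<psi> j e \<in> K" if "j < n" "e \<in> A j" for j e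
    using \<psi>[OF that(1)] that(2) by (simp add: proper_edge_coloring_def)
  define N where "N j = card (A j)" for j
  have sum_le: "(\<Sum>j\<in>J. N j) \<le> t" if "J \<subseteq> {..<n}" for J
    using sum_layers[OF that] total by (simp add: N_def)
  have pair: "N j + N l \<le> t" if "j < n" "l < n" "j \<noteq> l" for j l
    using sum_le[of "{j, l}"] that by simp
  have triple: "N i + N j + N l \<le> t" if "i < n" "j < n" "l < n" "i \<noteq> j" "j \<noteq> l" "i \<noteq> l" for i j l
    using sum_le[of "{i, j, l}"] that by simp
  have N0: "N j = 0 \<longleftrightarrow> A j = {}" if "j < n" for j using that fin by (simp add: N_def)
  have few: "card {e \<in> A j. P e} \<le> N j" if "j < n" for j P
    unfolding N_def by (rule card_mono) (use fin that in auto)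
  have "\<exists>a\<in>K. a \<notin> {c} \<and> (\<forall>j<n. \<forall>e\<in>A j. \<psi> j e \<noteq> a)"
    by (rule unused_color) (use A total in simp_all)
  then obtain a where a: "a \<in> K" "c \<noteq> a" "\<And>j e. j < n \<Longrightarrow> e \<in> A j \<Longrightarrow> \<psi> j e \<noteq> a"
    by blast
  consider (heavy) l where "l < n" "t \<le> N l"
    | (absent) "\<forall>j<n. N j < t" "\<forall>i\<in>{h, ?h'}. \<forall>e\<in>A i. \<psi> i e \<noteq> c"
    | (confined) "\<forall>j<n. N j < t" "\<forall>j<n. j \<noteq> h \<longrightarrow> j \<noteq> ?h' \<longrightarrow> A j = {}"
    | (one_sided) i g where "\<forall>j<n. N j < t" "i \<in> {h, ?h'}" "t - 1 \<le> N i"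
        "g < n" "g \<noteq> h" "g \<noteq> ?h'" "A g \<noteq> {}"
    | (spread) i e g where "N h < t - 1" "N ?h' < t - 1" "\<forall>j<n. N j < t"
        "i \<in> {h, ?h'}" "e \<in> A i" "\<psi> i e = c" "g < n" "g \<noteq> h" "g \<noteq> ?h'" "A g \<noteq> {}"
  proof (cases "\<forall>j<n. N j < t")
    case False
    then show ?thesis using heavy by (meson not_le)
  next
    case small: True
    show ?thesis
    proof (cases "\<forall>i\<in>{h, ?h'}. \<forall>e\<in>A i. \<psi> i e \<noteq> c")
      case True
      then show ?thesis using absent small by blast
    next
      case False
      then obtain i e where ie: "i \<in> {h, ?h'}" "e \<in> A i" "\<psi> i e = c" by blast
      show ?thesis
      proof (cases "\<forall>j<n. j \<noteq> h \<longrightarrow> j \<noteq> ?h' \<longrightarrow> A j = {}")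
        case True
        then show ?thesis using confined small by blast
      next
        case False
        then obtain g where g: "g < n" "g \<noteq> h" "g \<noteq> ?h'" "A g \<noteq> {}" by blast
        show ?thesis
        proof (cases "N h < t - 1 \<and> N ?h' < t - 1")
          case True
          then show ?thesis using spread[OF _ _ small ie g] by blast
        next
          case False
          then obtain i' where "i' \<in> {h, ?h'}" "t - 1 \<le> N i'" by (auto simp: not_less)
          then show ?thesis using one_sided[OF small _ _ g] by blast
        qed
      qed
    qed
  qed
  then show ?thesis
  proof cases
    case heavy
    have zero: "A j = {}" if "j < n" "j \<noteq> l" for j
      using pair[OF that(1) heavy(1) that(2)] heavy(2) N0[OF that(1)] by simp
    have "N l \<le> t" using sum_le[of "{l}"] heavy by simp
    have "card {c} < card K" using card_K by simp
    then obtain a' where a': "a' \<in> K" "a' \<noteq> c" using ex_outside[of "{c}" K] by auto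
    have "A l \<noteq> {}" using heavy t_ge N0 by fastforce
    then obtain e where e: "e \<in> A l" by blast
    define a where "a = (if \<psi> l e = c then a' else \<psi> l e)"
    have a: "a \<in> K" "c \<noteq> a" "\<psi> l e \<in> {c, a}" using a' K[OF heavy(1) e] by (auto simp: a_def)
    show ?thesis
    proof (rule extend_alternating[where A = A and \<psi> = \<psi> and c = c and a = a and
        \<epsilon> = "even h" and r = "\<lambda>_. l" and Fl = "{}"])
      show ?thesis if "compatible F M" "\<And>j e. j < n \<Longrightarrow> e \<in> A j \<Longrightarrow> F j e = \<psi> j e"
        "\<And>j x. j < n \<Longrightarrow> even j = even h \<Longrightarrow> x \<notin> {} \<Longrightarrow>
          \<forall>i\<in>{j, nxt n j}. \<forall>e\<in>A i. \<psi> i e = c \<longrightarrow> x \<notin> e \<Longrightarrow> M j x = c" for F M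
        using that(1,2) that(3)[of h v] h(1) v by blast
      show "card {e \<in> A j. \<psi> j e \<notin> {c, a}} < t" if j: "j < n" for j
      proof (cases "j = l")
        case True
        have "card {e \<in> A j. \<psi> j e \<notin> {c, a}} < card (A l)"
          by (rule psubset_card_mono) (use fin heavy(1) e a(3) True in auto)
        then show ?thesis using \<open>N l \<le> t\<close> by (simp add: N_def)
      next
        case False
        then show ?thesis using zero[OF j] t_ge by simp
      qed
      show "l = j" if "j < n" "A j \<noteq> {}" for j using zero that by blast
    qed (fact A \<psi> h a | simp add: heavy)+
  next
    case absent
    define L where "L j = (if j = h then {c} else K - \<psi> j ` A j - \<psi> (nxt n j) ` A (nxt n j))" for j
    have L: "t + 2 \<le> card (L j) + (N j + N (nxt n j))" if "j < n" "j \<noteq> h" for j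
      using free_colors[OF fin[OF that(1)] fin[OF nxt_less[OF that(1)]]] that(2) by (simp add: L_def N_def)
    have L2: "2 \<le> card (L j)" if "j < n" "j \<noteq> h" for j
      using L[OF that] pair[OF that(1) nxt_less[OF that(1)]] nxt_neq[OF that(1)] by simp
    have Lh: "L h \<noteq> {}" by (simp add: L_def)
    let ?p = "prv n h"
    have p: "?p < n" "nxt n ?p = h" using h by (simp_all add: prv_less nxt_prv)
    have "?p \<noteq> h" using p nxt_neq by metis
    have "2 \<le> n" using n_ge by simp
    \<comment> \<open>If the lists of the gaps on both sides of \<open>h\<close> had size two, each of two disjoint pairs of
      layers would contain \<open>t\<close> precoloured edges.\<close>
    have "\<exists>m. \<forall>j<n. m j \<in> L j \<and> m j \<noteq> m (nxt n j)"
    proof (cases "3 \<le> card (L ?p)")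
      case True
      then show ?thesis using cycle_list_coloring[of n ?p L] p Lh L2 \<open>2 \<le> n\<close> by simp
    next
      case False
      then have "t \<le> N ?p + N h" using L[OF p(1) \<open>?p \<noteq> h\<close>] p(2) by simp
      moreover have "?h' \<noteq> h" "nxt n ?h' \<noteq> h" "?h' \<noteq> ?p" "nxt n ?h' \<noteq> ?p" "nxt n ?h' < n"
        using nxt_neq[OF h(1)] nxt2_neq[OF h(1)] nxt2_neq[OF p(1)] nxt3_neq[OF p(1)] p(2) nxt_less[OF h'] by auto
      ultimately have "N ?h' = 0" "N (nxt n ?h') = 0"
        using triple[OF p(1) h(1) h'] triple[OF p(1) h(1), of "nxt n ?h'"] \<open>?p \<noteq> h\<close> by force+
      then have "3 \<le> card (L ?h')" using L[OF h' \<open>?h' \<noteq> h\<close>] t_ge by simp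
      then show ?thesis
        using cycle_list_coloring_rev[of n ?h' L] prv_nxt[OF h(1)] h' Lh L2 \<open>2 \<le> n\<close> by simp
    qed
    then obtain m where m: "\<And>j. j < n \<Longrightarrow> m j \<in> L j \<and> m j \<noteq> m (nxt n j)" by blast
    have mh: "m h = c" using m[OF h(1)] by (simp add: L_def)
    have "m j \<in> K - \<psi> j ` A j - \<psi> (nxt n j) ` A (nxt n j)" if "j < n" for j
    proof (cases "j = h")
      case True
      then show ?thesis using mh h(3) absent(2) by auto
    next
      case False
      then show ?thesis using m[OF that] by (simp add: L_def)
    qed
    then have "\<exists>F. compatible F (\<lambda>j x. m j) \<and> (\<forall>j<n. \<forall>e\<in>A j. F j e = \<psi> j e)"
      by (intro extend_uniform[OF A \<psi>]) (use absent(1) m in \<open>auto simp: N_def\<close>)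
    then show ?thesis using mh by (elim exE conjE) (rule exI, rule exI, intro conjI, assumption+)
  next
    case confined
    show ?thesis
    proof (rule extend_paired[where A = A and \<psi> = \<psi> and c = c and a = a and
        \<epsilon> = "odd h" and Fl = "{v}"])
      show ?thesis if "compatible F M" "\<And>j e. j < n \<Longrightarrow> e \<in> A j \<Longrightarrow> F j e = \<psi> j e"
        "\<And>j x. j < n \<Longrightarrow> x \<in> {v} \<Longrightarrow> even j \<noteq> odd h \<Longrightarrow> M j x = c" for F M
        using that(1,2) that(3)[of h v] h(1) by blast
      show "card {e \<in> A j. \<psi> j e \<noteq> c} < t" if "j < n" for j
        by (rule le_less_trans[OF few[OF that]]) (use confined(1) that in blast)
      show "A j = {} \<or> A (nxt n j) = {}" if j: "j < n" "even j = odd h" for j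
      proof (rule ccontr)
        assume "\<not> (A j = {} \<or> A (nxt n j) = {})"
        then have "j \<in> {h, ?h'}" "nxt n j \<in> {h, ?h'}" using confined(2) j(1) nxt_less by blast+
        then show False
          using j nxt_neq[OF h(1)] nxt_neq[OF h'] nxt2_neq[OF h(1)] by auto
      qed
      show "e \<inter> {v} = {}" if "j < n" "e \<in> A j" "\<psi> j e = c" for j e
        using v[of j e] confined(2) that by blast
    qed (fact A \<psi> h a)+
  next
    case one_sided
    have i: "i < n" using one_sided(2) h(1) h' by auto
    have "N g \<noteq> 0" using one_sided(4,7) N0 by blast
    have zero: "A j = {}" if "j < n" "j \<noteq> i" "j \<noteq> g" for j
    proof -
      have "N j + N i + N g \<le> t" using triple[OF that(1) i one_sided(4) that(2)] that(3) one_sided(2,5,6) by blast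
      then have "N j = 0" using one_sided(3) \<open>N g \<noteq> 0\<close> by arith
      then show ?thesis using N0[OF that(1)] by simp
    qed
    show ?thesis
    proof (rule extend_paired[where A = A and \<psi> = \<psi> and c = c and a = a and
        \<epsilon> = "even h" and Fl = "{}"])
      show ?thesis if "compatible F M" "\<And>j e. j < n \<Longrightarrow> e \<in> A j \<Longrightarrow> F j e = \<psi> j e"
        "\<And>j x. j < n \<Longrightarrow> even j = even h \<Longrightarrow> x \<notin> {} \<Longrightarrow>
          \<forall>i\<in>{j, nxt n j}. \<forall>e\<in>A i. \<psi> i e = c \<longrightarrow> x \<notin> e \<Longrightarrow> M j x = c" for F M
        using that(1,2) that(3)[of h v] h(1) v by blast
      show "card {e \<in> A j. \<psi> j e \<noteq> c} < t" if "j < n" for j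
        by (rule le_less_trans[OF few[OF that]]) (use one_sided(1) that in blast)
      show "A j = {} \<or> A (nxt n j) = {}" if j: "j < n" "even j = even h" for j
      proof (rule ccontr)
        assume "\<not> (A j = {} \<or> A (nxt n j) = {})"
        then have "j = i \<and> nxt n j = g \<or> j = g \<and> nxt n j = i"
          using zero[of j] zero[of "nxt n j"] j(1) nxt_less nxt_neq[OF j(1)] by metis
        then have "{j, nxt n j} = {i, g}" by blast
        moreover have "j = h \<or> nxt n j = ?h'"
          using calculation one_sided(2,5,6) j even_nxt[OF h(1)] even_nxt[OF j(1)] by (auto simp: doubleton_eq_iff)
        then have "j = h" using prv_nxt[OF h(1)] prv_nxt[OF j(1)] by metis
        ultimately show False using one_sided(5,6) by blast
      qed
    qed (fact A \<psi> h a | simp)+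
  next
    case spread
    have i: "i < n" using spread(4) h(1) h' by auto
    define Nb where "Nb = {w. {v, w} \<in> E}"
    have "Nb \<subseteq> \<Union>E" by (auto simp: Nb_def)
    \<comment> \<open>A precoloured edge touches at most one neighbour of \<open>v\<close>, because \<open>H\<close> has no triangles; so fewer
      than \<open>t\<close> edges cannot touch all neighbours.\<close>
    define f where "f e = (THE w. w \<in> e \<and> w \<in> Nb)" for e
    have f: "f e = w" if "e \<in> E" "w \<in> e" "w \<in> Nb" for e w
      unfolding f_def
    proof (rule the_equality)
      show "w \<in> e \<and> w \<in> Nb" using that by blast
      show "w' = w" if w': "w' \<in> e \<and> w' \<in> Nb" for w'
      proof (rule ccontr)
        assume "w' \<noteq> w"
        moreover have "card e = 2" using edge \<open>e \<in> E\<close> by blast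
        ultimately have "e = {w, w'}" using w' \<open>w \<in> e\<close> by (auto simp: card_2_iff)
        then show False using triangle_free[of v w w'] w' \<open>w \<in> Nb\<close> \<open>e \<in> E\<close> by (simp add: Nb_def)
      qed
    qed
    have "N h + N ?h' < t"
      using triple[OF h(1) h' spread(7)] spread(8,9,10) nxt_neq[OF h(1)] N0[OF spread(7)] by fastforce
    moreover have "card (f ` (A h \<union> A ?h')) \<le> N h + N ?h'"
      unfolding N_def using card_image_le[of "A h \<union> A ?h'" f] card_Un_le[of "A h" "A ?h'"] fin h(1) h'
      by fastforce
    moreover have "t \<le> card Nb" using min_degree[OF h(2)] by (simp add: Nb_def)
    ultimately have "card (f ` (A h \<union> A ?h')) < card Nb" by simp
    then obtain w where w: "w \<in> Nb" "w \<notin> f ` (A h \<union> A ?h')"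
      using ex_outside[of "f ` (A h \<union> A ?h')" Nb] fin h(1) h' by auto
    define d where "d = {v, w}"
    have dE: "d \<in> E" using w(1) by (simp add: Nb_def d_def)
    have untouched: "w \<notin> e" if "j \<in> {h, ?h'}" "e \<in> A j" for j e
    proof
      assume "w \<in> e"
      moreover have "e \<in> E" using that A[OF h(1)] A[OF h'] by auto
      ultimately have "f e = w" using f w(1) by blast
      then show False using w(2) that by auto
    qed
    have d_notin: "d \<notin> A j" if "j \<in> {h, ?h'}" for j
      using untouched[OF that] by (auto simp: d_def)
    define A' where "A' j = (if j \<in> {h, ?h'} then insert d (A j) else A j)" for j
    define \<psi>' where "\<psi>' j = (if j \<in> {h, ?h'} then (\<psi> j)(d := c) else \<psi> j)" for j
    have S': "\<psi>' j ` A' j = (if j \<in> {h, ?h'} then insert c (\<psi> j ` A j) else \<psi> j ` A j)" for j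
      using d_notin[of j] by (auto simp: A'_def \<psi>'_def image_iff)
    have A': "A' j \<subseteq> E" if "j < n" for j using A[OF that] dE by (auto simp: A'_def)
    have pc': "proper_edge_coloring (A' j) K (\<psi>' j)" if j: "j < n" for j
    proof (cases "j \<in> {h, ?h'}")
      case True
      have "\<psi> j e \<noteq> c" if "e \<in> A j" "e \<inter> d \<noteq> {}" for e
        using v[OF True that(1)] untouched[OF True that(1)] that(2) by (auto simp: d_def)
      then show ?thesis
        using \<psi>[OF j] h(3) True d_notin[OF True]
        by (auto simp: proper_edge_coloring_def A'_def \<psi>'_def Int_commute)
    next
      case False
      then show ?thesis using \<psi>[OF j] by (simp add: A'_def \<psi>'_def)
    qed
    have small': "card (A' j) < t" if j: "j < n" for j
      using spread(1-3) j card_insert_le_m1[of t "A j" d] fin[OF j]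
      by (auto simp: A'_def N_def card_insert_if)
    define L where "L j = K - \<psi>' j ` A' j - \<psi>' (nxt n j) ` A' (nxt n j)" for j
    have L: "t + 2 \<le> card (K - \<psi> j ` A j - \<psi> (nxt n j) ` A (nxt n j)) + (N j + N (nxt n j))"
      if "j < n" for j
      using free_colors[OF fin[OF that] fin[OF nxt_less[OF that]]] by (simp add: N_def)
    \<comment> \<open>In layer \<open>i\<close> the colour \<open>c\<close> occurs already, so the new edges shorten no list next to layer \<open>i\<close>.
      Elsewhere the edge \<open>e\<close> of layer \<open>i\<close> does not count and compensates for the loss.\<close>
    have L_eq: "L j = K - \<psi> j ` A j - \<psi> (nxt n j) ` A (nxt n j)" if "i \<in> {j, nxt n j}" for j
      using that spread(5,6) by (auto simp: L_def S')
    have L3: "3 \<le> card (L h)" using L[OF h(1)] L_eq[of h] spread(4) \<open>N h + N ?h' < t\<close> by simp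
    have L2: "2 \<le> card (L j)" if j: "j < n" for j
    proof (cases "i \<in> {j, nxt n j}")
      case True
      then show ?thesis
        using L[OF j] L_eq pair[OF j nxt_less[OF j]] nxt_neq[OF j] by simp
    next
      case False
      have "N i \<noteq> 0" using N0[OF i] spread(5) by blast
      then have "N j + N (nxt n j) < t"
        using triple[OF i j nxt_less[OF j]] False nxt_neq[OF j] by fastforce
      then have "3 \<le> card (K - \<psi> j ` A j - \<psi> (nxt n j) ` A (nxt n j))" using L[OF j] by simp
      moreover have "K - \<psi> j ` A j - \<psi> (nxt n j) ` A (nxt n j) \<subseteq> insert c (L j)"
        by (auto simp: L_def S')
      moreover have "finite (L j)" using finite_K by (simp add: L_def)
      ultimately have "3 \<le> card (insert c (L j))"
        by (meson card_mono finite_insert le_trans)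
      then show ?thesis using card_insert_le_m1[of "card (L j) + 1" "L j" c] by simp
    qed
    have "\<exists>m. \<forall>j<n. m j \<in> L j \<and> m j \<noteq> m (nxt n j)"
      by (rule cycle_list_coloring[where i = h]) (use h(1) L3 L2 n_ge L2[OF h'] in auto)
    then obtain m where m: "\<And>j. j < n \<Longrightarrow> m j \<in> L j \<and> m j \<noteq> m (nxt n j)" by blast
    then have "\<exists>F. compatible F (\<lambda>j x. m j) \<and> (\<forall>j<n. \<forall>e\<in>A' j. F j e = \<psi>' j e)"
      by (intro extend_uniform[OF A' pc' small']) (auto simp: L_def)
    then obtain F where F: "compatible F (\<lambda>j x. m j)" "\<And>j e. j < n \<Longrightarrow> e \<in> A' j \<Longrightarrow> F j e = \<psi>' j e"
      by blast
    have Fd: "F h d = c" "F ?h' d = c"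
      using F(2)[OF h(1), of d] F(2)[OF h', of d] by (simp_all add: A'_def \<psi>'_def)
    define W where "W j = (if j = h then {d} else {})" for j
    obtain F' M' where comp': "compatible F' M'"
      and F'_in: "\<And>j e. j < n \<Longrightarrow> e \<in> W j \<Longrightarrow> F' j e = m j \<and> F' (nxt n j) e = m j"
      and F'_out: "\<And>j e. j < n \<Longrightarrow> e \<notin> W j \<Longrightarrow> e \<notin> W (prv n j) \<Longrightarrow> F' j e = F j e"
      and M'_in: "\<And>j e x. j < n \<Longrightarrow> e \<in> W j \<Longrightarrow> x \<in> e \<Longrightarrow> M' j x = F j e"
      and M'_out: "\<And>j x. j < n \<Longrightarrow> \<forall>e\<in>W j. x \<notin> e \<Longrightarrow> M' j x = m j"
    proof (rule swap_squares[OF F(1), where W = W and \<mu> = m])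
      show "W j \<inter> W (nxt n j) = {}" if "j < n" for j
        using nxt_neq[OF that] by (simp add: W_def)
      show "W j \<subseteq> E" for j using dE by (simp add: W_def)
      show "e = e'" if "e \<in> W j" "e' \<in> W j" for j e e'
        using that by (simp add: W_def split: if_splits)
      show "F j e = F (nxt n j) e" if "e \<in> W j" for j e
        using that Fd by (simp add: W_def split: if_splits)
    qed (use that in blast)+
    have "M' h v = c" using M'_in[OF h(1), of d v] Fd by (simp add: W_def d_def)
    moreover have "F' j e = \<psi> j e" if j: "j < n" "e \<in> A j" for j e
    proof -
      have "e \<noteq> d" if "j \<in> {h, ?h'}" using d_notin[OF that] j(2) by blast
      then have "e \<notin> W j" "e \<notin> W (prv n j)" "\<psi>' j e = \<psi> j e"
        using nxt_prv[OF j(1)] by (auto simp: W_def \<psi>'_def)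
      moreover have "e \<in> A' j" using j(2) by (simp add: A'_def)
      ultimately show ?thesis using F'_out[OF j(1)] F(2)[OF j(1)] by simp
    qed
    ultimately show ?thesis using comp' by blast
  qed
qed

section \<open>Extending a precolouring of a product\<close>

text \<open>
  For the base case, where \<open>H\<close> is a single vertex and the product an even cycle: alternate two
  colours.
\<close>

lemma extend_edgeless:
  assumes "E = {}" "c \<in> K"
  shows "\<exists>F M. compatible F M \<and> M h v = c"
proof -
  have "card {c} < card K" using card_K by simp
  then obtain a where a: "a \<in> K" "a \<noteq> c" using ex_outside[of "{c}" K] by auto
  have "compatible (\<lambda>j e. c) (\<lambda>j x. alternate (even h) c a j)"
    unfolding compatible_def using assms a
    by (auto simp: proper_edge_coloring_def alternate_nxt) (auto simp: alternate_def split: if_splits)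
  then show ?thesis by (intro exI conjI) (assumption, simp add: alternate_def)
qed

text \<open>
  The injection \<open>p\<close> names the vertices of the product, so that any coordinate of a power can
  play the vertical role. Layer edges and vertical edges are determined by their indices
  (\<open>inj_hor\<close>, \<open>inj_ver\<close>, \<open>disj\<close>), so the precolouring can be read off layer by layer, and
  compatible pieces can be glued together.
\<close>

lemma extend_product:
  fixes p :: "nat \<Rightarrow> 'b \<Rightarrow> 'v" and \<phi> :: "'v set \<Rightarrow> 'c"
  defines "horizontal \<equiv> {p j ` e | j e. j < n \<and> e \<in> E}"
    and "vertical \<equiv> {{p j x, p (nxt n j) x} | j x. j < n \<and> x \<in> V}"
  assumes t: "2 \<le> t \<or> E = {}"
    and inj: "\<And>j j' x x'. j < n \<Longrightarrow> j' < n \<Longrightarrow> x \<in> V \<Longrightarrow> x' \<in> V \<Longrightarrow> p j x = p j' x' \<Longrightarrow> j = j' \<and> x = x'"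
    and E': "E' \<subseteq> horizontal \<union> vertical" "finite E'" "card E' \<le> t + 1"
    and one: "card (E' \<inter> vertical) \<le> 1"
    and \<phi>: "proper_edge_coloring E' K \<phi>"
  shows "\<exists>f. proper_edge_coloring (horizontal \<union> vertical) K f \<and> (\<forall>e\<in>E'. f e = \<phi> e)"
proof -
  define ver where "ver = (\<lambda>(j, x). {p j x, p (nxt n j) x})"
  define hor where "hor = (\<lambda>(j, e). p j ` e)"
  have vertical: "vertical = ver ` ({..<n} \<times> V)"
    by (auto simp: vertical_def ver_def)
  have horizontal: "horizontal = hor ` ({..<n} \<times> E)"
    by (auto simp: horizontal_def hor_def)
  have inV: "x \<in> V" if "e \<in> E" "x \<in> e" for e x using edge that by blast
  have edge_ne: "\<exists>x. x \<in> e" if "e \<in> E" for e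
    using edge[OF that] by (metis card.empty equals0I zero_neq_numeral)
  have inj': "j = j' \<and> x = x'" if "p j x = p j' x'" "j < n" "j' < n" "x \<in> V" "x' \<in> V" for j j' x x'
    using inj that by blast
  have inj_p: "inj_on (p j) V" if "j < n" for j
    using inj'[OF _ that that] by (auto intro: inj_onI)
  have inj_hor: "inj_on hor ({..<n} \<times> E)"
  proof (rule inj_onI, clarsimp simp: hor_def)
    fix j e j' e' assume *: "j < n" "e \<in> E" "j' < n" "e' \<in> E" "p j ` e = p j' ` e'"
    obtain x where x: "x \<in> e" using edge_ne *(2) by blast
    then have "p j x \<in> p j' ` e'" using *(5) by blast
    then have "j = j'" using inj' * x inV by blast
    moreover have "e \<subseteq> V" "e' \<subseteq> V" using edge * by blast+
    ultimately show "j = j' \<and> e = e'"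
      using *(5) inj_on_image_eq_iff[OF inj_p[OF *(1)]] by simp
  qed
  have inj_ver: "inj_on ver ({..<n} \<times> V)"
  proof (rule inj_onI, clarsimp simp: ver_def)
    fix j x j' x' assume *: "j < n" "x \<in> V" "j' < n" "x' \<in> V"
      "{p j x, p (nxt n j) x} = {p j' x', p (nxt n j') x'}"
    note nx = nxt_less[OF *(1)] nxt_less[OF *(3)]
    from *(5) have "p j x = p j' x' \<or> p j x = p (nxt n j') x' \<and> p (nxt n j) x = p j' x'"
      by (auto simp: doubleton_eq_iff)
    then show "j = j' \<and> x = x'"
      using inj'[of j x j' x'] inj'[of j x "nxt n j'" x'] inj'[of "nxt n j" x j' x']
        * nx nxt2_neq[OF *(1)] by auto
  qed
  have disj: "hor (j, e) \<noteq> ver (i, x)" if "j < n" "e \<in> E" "i < n" "x \<in> V" for j e i x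
  proof
    assume "hor (j, e) = ver (i, x)"
    then have "p i x \<in> p j ` e" "p (nxt n i) x \<in> p j ` e" by (auto simp: hor_def ver_def)
    then have "i = j" "nxt n i = j"
      using inj' that inV nxt_less[OF that(3)] by blast+
    then show False using nxt_neq[OF that(3)] by simp
  qed
  define A where "A j = {e \<in> E. hor (j, e) \<in> E'}" for j
  define \<psi> where "\<psi> j e = \<phi> (hor (j, e))" for j e
  have A: "A j \<subseteq> E" for j by (auto simp: A_def)
  have \<phi>_K: "\<phi> e \<in> K" if "e \<in> E'" for e using \<phi> that by (simp add: proper_edge_coloring_def)
  have \<phi>_neq: "\<phi> e \<noteq> \<phi> e'" if "e \<in> E'" "e' \<in> E'" "e \<noteq> e'" "x \<in> e" "x \<in> e'" for e e' x
    using \<phi> that unfolding proper_edge_coloring_def by blast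
  have \<psi>: "proper_edge_coloring (A j) K (\<psi> j)" if j: "j < n" for j
    unfolding proper_edge_coloring_def
  proof (intro conjI ballI impI)
    show "\<psi> j e \<in> K" if "e \<in> A j" for e using that \<phi>_K by (simp add: A_def \<psi>_def)
    fix e e' assume e: "e \<in> A j" "e' \<in> A j" "e \<noteq> e' \<and> e \<inter> e' \<noteq> {}"
    then obtain x where "x \<in> e" "x \<in> e'" by blast
    moreover have "hor (j, e) \<noteq> hor (j, e')"
      using e j inj_onD[OF inj_hor, of "(j, e)" "(j, e')"] by (auto simp: A_def)
    ultimately show "\<psi> j e \<noteq> \<psi> j e'"
      using e \<phi>_neq[of "hor (j, e)" "hor (j, e')" "p j x"] by (auto simp: A_def \<psi>_def hor_def)
  qed
  have "(\<Sum>j<n. card (A j)) = card (SIGMA j:{..<n}. A j)"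
    using A finite_layer by simp
  also have "\<dots> \<le> card (E' - vertical)"
  proof (rule card_inj_on_le[of hor])
    show "inj_on hor (SIGMA j:{..<n}. A j)"
      by (rule inj_on_subset[OF inj_hor]) (auto simp: A_def)
    show "hor ` (SIGMA j:{..<n}. A j) \<subseteq> E' - vertical"
      using disj by (auto simp: A_def vertical)
  qed (use E' in simp)
  also have "\<dots> = card E' - card (E' \<inter> vertical)"
    using E'(2) by (simp add: card_Diff_subset_Int)
  finally have total: "(\<Sum>j<n. card (A j)) \<le> card E' - card (E' \<inter> vertical)" .
  have "\<exists>F M. compatible F M \<and> (\<forall>j<n. \<forall>e\<in>A j. F j e = \<psi> j e) \<and>
      (\<forall>j<n. \<forall>x\<in>V. ver (j, x) \<in> E' \<longrightarrow> M j x = \<phi> (ver (j, x)))"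
  proof (cases "E' \<inter> vertical = {}")
    case True
    then have "ver (j, x) \<notin> E'" if "j < n" "x \<in> V" for j x
      using that by (auto simp: vertical)
    moreover have "\<exists>F M. compatible F M \<and> (\<forall>j<n. \<forall>e\<in>A j. F j e = \<psi> j e)"
    proof (cases "2 \<le> t")
      case True
      show ?thesis
        by (rule extend_layers) (use True A \<psi> total E' in auto)
    next
      case False
      then have "E = {}" using t by simp
      moreover obtain c where "c \<in> K" using card_K by fastforce
      ultimately show ?thesis using extend_edgeless A by blast
    qed
    ultimately show ?thesis by blast
  next
    case False
    then obtain h v where h: "h < n" "v \<in> V" "ver (h, v) \<in> E'" by (auto simp: vertical)
    have vin: "ver (h, v) \<in> vertical" using h by (auto simp: vertical)
    have only: "j = h \<and> x = v" if "j < n" "x \<in> V" "ver (j, x) \<in> E'" for j x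
    proof -
      have "ver (j, x) \<in> vertical" using that by (auto simp: vertical)
      then have "ver (j, x) = ver (h, v)"
        using one h(3) vin that(3) E'(2) by (auto simp: card_le_Suc0_iff_eq)
      then show ?thesis using inj_onD[OF inj_ver, of "(j, x)" "(h, v)"] that h by auto
    qed
    have "card (E' \<inter> vertical) \<noteq> 0" using False E'(2) by simp
    then have total': "(\<Sum>j<n. card (A j)) \<le> t" using total E'(3) by simp
    define c where "c = \<phi> (ver (h, v))"
    have c: "c \<in> K" using \<phi>_K h(3) by (simp add: c_def)
    have "\<exists>F M. compatible F M \<and> (\<forall>j<n. \<forall>e\<in>A j. F j e = \<psi> j e) \<and> M h v = c"
    proof (cases "2 \<le> t")
      case True
      have avoid: "\<psi> i e \<noteq> c" if "i \<in> {h, nxt n h}" "e \<in> A i" "v \<in> e" for i e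
      proof -
        have i: "i < n" using that(1) h(1) nxt_less by blast
        then have "hor (i, e) \<noteq> ver (h, v)" using disj that(2) h A by blast
        moreover have "p i v \<in> hor (i, e)" "p i v \<in> ver (h, v)"
          using that by (auto simp: hor_def ver_def)
        ultimately show ?thesis
          using \<phi>_neq[of "hor (i, e)" "ver (h, v)"] that(2) h(3) by (auto simp: A_def \<psi>_def c_def)
      qed
      show ?thesis
        by (rule extend_layers_vertical) (use True A \<psi> total' h c avoid in auto)
    next
      case False
      then have "E = {}" using t by simp
      then show ?thesis using extend_edgeless[OF _ c, of h v] A by blast
    qed
    then show ?thesis using only c_def by metis
  qed
  then obtain F M where FM: "compatible F M" "\<And>j e. j < n \<Longrightarrow> e \<in> A j \<Longrightarrow> F j e = \<psi> j e"
    "\<And>j x. j < n \<Longrightarrow> x \<in> V \<Longrightarrow> ver (j, x) \<in> E' \<Longrightarrow> M j x = \<phi> (ver (j, x))" by blast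
  have pcol: "F j e \<in> K" "e' \<in> E \<Longrightarrow> e \<noteq> e' \<Longrightarrow> x \<in> e \<Longrightarrow> x \<in> e' \<Longrightarrow> F j e \<noteq> F j e'"
    if "j < n" "e \<in> E" for j e e' x
    using FM(1) that unfolding compatible_def proper_edge_coloring_def by blast+
  have vert: "M j x \<in> K" "M j x \<noteq> M (nxt n j) x" if "j < n" "x \<in> V" for j x
    using FM(1) that unfolding compatible_def by blast+
  have cross: "F j e \<noteq> M j x" "F (nxt n j) e \<noteq> M j x" if "j < n" "e \<in> E" "x \<in> e" for j e x
    using FM(1) that unfolding compatible_def by blast+
  define f where "f X = (if X \<in> vertical then case_prod M (inv_into ({..<n} \<times> V) ver X)
      else case_prod F (inv_into ({..<n} \<times> E) hor X))" for X
  have f_ver: "f (ver (j, x)) = M j x" if "j < n" "x \<in> V" for j x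
    using that inv_into_f_f[OF inj_ver, of "(j, x)"] by (auto simp: f_def vertical)
  have f_hor: "f (hor (j, e)) = F j e" if "j < n" "e \<in> E" for j e
    using that disj[OF that] inv_into_f_f[OF inj_hor, of "(j, e)"] by (auto simp: f_def vertical)
  have cases: thesis
    if "X \<in> horizontal \<union> vertical"
      "\<And>j e. X = hor (j, e) \<Longrightarrow> j < n \<Longrightarrow> e \<in> E \<Longrightarrow> thesis"
      "\<And>j x. X = ver (j, x) \<Longrightarrow> j < n \<Longrightarrow> x \<in> V \<Longrightarrow> thesis" for X thesis
    using that unfolding horizontal vertical by blast
  have hor_ver: "F j e \<noteq> M i x"
    if meet: "hor (j, e) \<inter> ver (i, x) \<noteq> {}" and that: "j < n" "e \<in> E" "i < n" "x \<in> V" for j e i x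
  proof -
    obtain z where "z \<in> hor (j, e)" "z \<in> ver (i, x)" using meet by blast
    then obtain y where y: "y \<in> e" "p j y = p i x \<or> p j y = p (nxt n i) x"
      by (auto simp: hor_def ver_def)
    then have "y = x \<and> (j = i \<or> j = nxt n i)"
      using inj'[of j y i x] inj'[of j y "nxt n i" x] that inV nxt_less by blast
    then show ?thesis using cross[OF that(3,2)] y(1) by blast
  qed
  have "f X \<noteq> f Y" if X: "X \<in> horizontal \<union> vertical" and Y: "Y \<in> horizontal \<union> vertical"
    and XY: "X \<noteq> Y" "X \<inter> Y \<noteq> {}" for X Y
  proof (rule cases[OF X]; rule cases[OF Y])
    fix j e j' e' assume X: "X = hor (j, e)" "j < n" "e \<in> E" and Y: "Y = hor (j', e')" "j' < n" "e' \<in> E"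
    obtain x x' where x: "x \<in> e" "x' \<in> e'" "p j x = p j' x'" using XY(2) X(1) Y(1) by (auto simp: hor_def)
    then have "j = j'" "x = x'" using inj' X Y inV by blast+
    then show "f X \<noteq> f Y" using X Y x XY(1) pcol(2) f_hor by metis
  next
    fix j e i x assume "X = hor (j, e)" "j < n" "e \<in> E" "Y = ver (i, x)" "i < n" "x \<in> V"
    then show "f X \<noteq> f Y" using XY hor_ver f_hor f_ver by metis
  next
    fix j e i x assume "Y = hor (j, e)" "j < n" "e \<in> E" "X = ver (i, x)" "i < n" "x \<in> V"
    then show "f X \<noteq> f Y" using XY hor_ver f_hor f_ver by (metis Int_commute)
  next
    fix j x j' x' assume X: "X = ver (j, x)" "j < n" "x \<in> V" and Y: "Y = ver (j', x')" "j' < n" "x' \<in> V"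
    note nx = nxt_less[OF X(2)] nxt_less[OF Y(2)]
    have "p j x = p j' x' \<or> p j x = p (nxt n j') x' \<or> p (nxt n j) x = p j' x' \<or>
        p (nxt n j) x = p (nxt n j') x'" using XY(2) X(1) Y(1) by (auto simp: ver_def)
    then have "x = x' \<and> (j = j' \<or> j = nxt n j' \<or> nxt n j = j' \<or> nxt n j = nxt n j')"
      using inj'[OF _ X(2) Y(2) X(3) Y(3)] inj'[OF _ X(2) nx(2) X(3) Y(3)]
        inj'[OF _ nx(1) Y(2) X(3) Y(3)] inj'[OF _ nx(1) nx(2) X(3) Y(3)] by blast
    then have "x = x'" "j = nxt n j' \<or> nxt n j = j'"
      using XY(1) X Y prv_nxt by metis+
    then show "f X \<noteq> f Y" using X Y f_ver vert(2) by metis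
  qed
  moreover have "f X \<in> K" if "X \<in> horizontal \<union> vertical" for X
    by (rule cases[OF that]) (use f_hor f_ver pcol(1) vert(1) in auto)
  moreover have "f X = \<phi> X" if "X \<in> E'" for X
  proof -
    have "X \<in> horizontal \<union> vertical" using that E'(1) by blast
    then show ?thesis
      by (rule cases) (use that f_hor f_ver FM in \<open>auto simp: A_def \<psi>_def\<close>)
  qed
  ultimately show ?thesis unfolding proper_edge_coloring_def by blast
qed

end

section \<open>Powers of a cycle\<close>

text \<open>
  Every edge of the power is oriented along its cycle: it moves one coordinate \<open>i\<close> forward, and
  \<open>i\<close> is its direction.
\<close>

definition step :: "nat \<Rightarrow> nat \<Rightarrow> nat list \<Rightarrow> nat list" where
  "step n i xs = xs[i := nxt n (xs ! i)]"

declare cart_power.simps(2) [simp del]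

lemma verts_cycle: "verts (cycle_graph n) = {..<n}"
  by (simp add: cycle_graph_def)

lemma verts_power: "verts (cart_power (cycle_graph n) d) = {xs. length xs = d \<and> set xs \<subseteq> {..<n}}"
  by (simp add: verts_cart_power verts_cycle)

lemma edges_cycle: "edges (cycle_graph n) = {{j, nxt n j} | j. j < n}"
  by (simp add: cycle_graph_def nxt_def)

lemma step_in_verts:
  assumes "xs \<in> verts (cart_power (cycle_graph n) d)" "i < d"
  shows "step n i xs \<in> verts (cart_power (cycle_graph n) d)"
proof -
  have xs: "length xs = d" "set xs \<subseteq> {..<n}" using assms(1) by (simp_all add: verts_power)
  then have "xs ! i < n" using assms(2) nth_mem by blast
  then have "set (xs[i := nxt n (xs ! i)]) \<subseteq> {..<n}"
    using xs(2) nxt_less by (intro subset_trans[OF set_update_subset_insert]) auto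
  then show ?thesis using assms by (simp add: verts_power step_def)
qed

lemma edges_power:
  "edges (cart_power (cycle_graph n) d) =
     {{xs, step n i xs} | xs i. xs \<in> verts (cart_power (cycle_graph n) d) \<and> i < d}"
proof (induction d)
  case 0
  then show ?case by simp
next
  case (Suc d)
  let ?C = "cycle_graph n"
  have "\<exists>xs i. e = {xs, step n i xs} \<and> xs \<in> verts (cart_power ?C (Suc d)) \<and> i < Suc d"
    if e: "e \<in> edges (cart_power ?C (Suc d))" for e
  proof -
    from e obtain e' where e': "e = (\<lambda>(x, xs). x # xs) ` e'" "e' \<in> edges (cart_prod ?C (cart_power ?C d))"
      by (auto simp: cart_power.simps(2) map_graph_def)
    then obtain u v u' v' where uv: "e' = {(u, v), (u', v')}"
      and *: "u < n" "v \<in> verts (cart_power ?C d)" "u' < n" "v' \<in> verts (cart_power ?C d)"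
      "u = u' \<and> {v, v'} \<in> edges (cart_power ?C d) \<or> {u, u'} \<in> edges ?C \<and> v = v'"
      unfolding cart_prod_def ugraph.simps mem_Collect_eq verts_cycle by blast
    have eq: "e = {u # v, u' # v'}" using e'(1) uv by simp
    from *(5) show ?thesis
    proof
      assume "u = u' \<and> {v, v'} \<in> edges (cart_power ?C d)"
      then obtain xs i where xs: "{v, v'} = {xs, step n i xs}" "xs \<in> verts (cart_power ?C d)" "i < d"
        and "u = u'" using Suc.IH by auto
      have "(#) u ` {v, v'} = (#) u ` {xs, step n i xs}" by (simp only: xs(1))
      then have "e = {u # xs, step n (Suc i) (u # xs)}"
        using eq \<open>u = u'\<close> by (simp add: step_def)
      moreover have "u # xs \<in> verts (cart_power ?C (Suc d))" using xs(2) *(1) by (simp add: verts_power)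
      ultimately show ?thesis using xs(3) by blast
    next
      assume "{u, u'} \<in> edges ?C \<and> v = v'"
      then obtain j where j: "{u, u'} = {j, nxt n j}" "j < n" "v = v'" by (auto simp: edges_cycle)
      have "(\<lambda>x. x # v) ` {u, u'} = (\<lambda>x. x # v) ` {j, nxt n j}" by (simp only: j(1))
      then have "e = {j # v, step n 0 (j # v)}"
        using eq j(3) by (simp add: step_def)
      moreover have "j # v \<in> verts (cart_power ?C (Suc d))" using *(2) j(2) by (simp add: verts_power)
      ultimately show ?thesis by blast
    qed
  qed
  moreover have "{xs, step n i xs} \<in> edges (cart_power ?C (Suc d))"
    if xs: "xs \<in> verts (cart_power ?C (Suc d))" and i: "i < Suc d" for xs i
  proof -
    obtain a as where as: "xs = a # as" "a < n" "as \<in> verts (cart_power ?C d)"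
      using xs by (auto simp: verts_power length_Suc_conv)
    show ?thesis
    proof (cases i)
      case 0
      have "nxt n a < n" using nxt_less as(2) by blast
      moreover have "{a, nxt n a} \<in> edges ?C" using as(2) by (auto simp: edges_cycle)
      moreover have "verts ?C = {..<n}" by (rule verts_cycle)
      ultimately show ?thesis using as 0 by (simp add: edges_cart_power_Suc step_def)
    next
      case (Suc k)
      have "step n k as \<in> verts (cart_power ?C d)"
        using step_in_verts[OF as(3)] i Suc by simp
      moreover have "{as, step n k as} \<in> edges (cart_power ?C d)"
        using as(3) i Suc Suc.IH by auto
      moreover have "verts ?C = {..<n}" by (rule verts_cycle)
      ultimately show ?thesis using as Suc by (simp add: edges_cart_power_Suc step_def)
    qed
  qed
  ultimately show ?case by blast
qed

lemma step_edge:
  "xs \<in> verts (cart_power (cycle_graph n) d) \<Longrightarrow> i < d \<Longrightarrow>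
    {xs, step n i xs} \<in> edges (cart_power (cycle_graph n) d)"
  unfolding edges_power by blast

lemma even_sum_list_update:
  fixes xs :: "nat list"
  assumes "i < length xs" "even y \<longleftrightarrow> odd (xs ! i)"
  shows "even (sum_list (xs[i := y])) \<longleftrightarrow> odd (sum_list xs)"
  using assms
proof (induction xs arbitrary: i)
  case (Cons a xs)
  then show ?case by (cases i) auto
qed simp

text \<open>
  The coordinate sum is a bipartition; at the seam of a cycle it drops by \<open>n - 1\<close>, which is odd.
\<close>

lemma parity_edge:
  assumes "even n" "{xs, ys} \<in> edges (cart_power (cycle_graph n) d)"
  shows "even (sum_list xs) \<longleftrightarrow> odd (sum_list ys)"
proof -
  obtain zs i where zs: "{xs, ys} = {zs, step n i zs}" "length zs = d" "set zs \<subseteq> {..<n}" "i < d"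
    using assms(2) by (auto simp: edges_power verts_power)
  have "zs ! i < n" using zs(2-4) nth_mem by blast
  then have "even (nxt n (zs ! i)) \<longleftrightarrow> odd (zs ! i)" using assms(1) by (auto simp: nxt_if)
  then have "even (sum_list (step n i zs)) \<longleftrightarrow> odd (sum_list zs)"
    using even_sum_list_update zs(2,4) by (simp add: step_def)
  then show ?thesis using zs(1) by (auto simp: doubleton_eq_iff)
qed

lemma degree_power:
  assumes "3 \<le> n" "xs \<in> verts (cart_power (cycle_graph n) d)"
  shows "2 * d \<le> card {ys. {xs, ys} \<in> edges (cart_power (cycle_graph n) d)}"
proof -
  let ?G = "cart_power (cycle_graph n) d"
  have xs: "length xs = d" "set xs \<subseteq> {..<n}" using assms(2) by (simp_all add: verts_power)
  have lt: "xs ! i < n" if "i < d" for i using xs that nth_mem by blast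
  define g where "g = (\<lambda>(i, b). xs[i := (if b then nxt n (xs ! i) else prv n (xs ! i))])"
  have neq: "nxt n j \<noteq> j" "prv n j \<noteq> j" "nxt n j \<noteq> prv n j" if "j < n" for j
    using that assms(1) by (auto simp: nxt_if prv_def)
  have "inj_on g ({..<d} \<times> UNIV)"
  proof (rule inj_onI, clarify)
    fix i b i' b' assume i: "i < d" "i' < d" and eq: "g (i, b) = g (i', b')"
    have nth: "g (i, b) ! k = (if k = i then (if b then nxt n (xs ! i) else prv n (xs ! i)) else xs ! k)"
      if "k < d" for k i b using that xs(1) by (simp add: g_def nth_list_update)
    have moved: "g (i, b) ! i \<noteq> xs ! i"
      using nth[OF i(1), of i b] neq(1,2)[OF lt[OF i(1)]] by simp
    have same: "i = i'"
    proof (rule ccontr)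
      assume "i \<noteq> i'"
      then have "g (i', b') ! i = xs ! i" using nth[OF i(1), of i' b'] by simp
      then show False using moved eq by simp
    qed
    have "g (i, b) ! i = g (i, b') ! i" using eq same by simp
    then have "b = b'"
      using nth[OF i(1), of i] neq(3)[OF lt[OF i(1)]] by (cases b; cases b') auto
    then show "i = i' \<and> b = b'" using same by simp
  qed
  then have "card (g ` ({..<d} \<times> (UNIV :: bool set))) = 2 * d"
    by (simp add: card_image card_cartesian_product)
  moreover have "g ` ({..<d} \<times> UNIV) \<subseteq> {ys. {xs, ys} \<in> edges ?G}"
  proof clarify
    fix i b assume i: "i < d"
    show "{xs, g (i, b)} \<in> edges ?G"
    proof (cases b)
      case True
      then have "g (i, b) = step n i xs" by (simp add: g_def step_def)
      then show ?thesis using step_edge[OF assms(2) i] by simp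
    next
      case False
      then have g: "g (i, b) = xs[i := prv n (xs ! i)]" by (simp add: g_def)
      have "set (g (i, b)) \<subseteq> {..<n}"
        unfolding g using xs prv_less[OF lt[OF i]]
        by (intro subset_trans[OF set_update_subset_insert]) auto
      then have "g (i, b) \<in> verts ?G" using g xs by (simp add: verts_power)
      moreover have "step n i (g (i, b)) = xs"
        using g i xs(1) nxt_prv[OF lt[OF i]] by (simp add: step_def)
      ultimately show ?thesis using step_edge[of "g (i, b)" n d i] i by (simp add: insert_commute)
    qed
  qed
  moreover have "finite {ys. {xs, ys} \<in> edges ?G}"
  proof (rule finite_subset)
    show "{ys. {xs, ys} \<in> edges ?G} \<subseteq> {ys. set ys \<subseteq> {..<n} \<and> length ys = d}"
      using simple_graph_cart_power[OF simple_graph_cycle_graph, of n d] assms(1)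
      by (fastforce simp: simple_graph_def verts_power)
  qed (rule finite_lists_length_eq, simp)
  ultimately show ?thesis by (metis card_mono)
qed

definition insert_nth :: "nat \<Rightarrow> 'a \<Rightarrow> 'a list \<Rightarrow> 'a list" where
  "insert_nth i x xs = take i xs @ x # drop i xs"

lemma length_insert_nth: "i \<le> length xs \<Longrightarrow> length (insert_nth i x xs) = Suc (length xs)"
  by (simp add: insert_nth_def)

lemma set_insert_nth: "set (insert_nth i x xs) = insert x (set xs)"
  by (simp add: insert_nth_def) (metis append_take_drop_id set_append)

lemma nth_insert_nth:
  assumes "i \<le> length xs" "k \<le> length xs"
  shows "insert_nth i x xs ! k = (if k < i then xs ! k else if k = i then x else xs ! (k - 1))"
  using assms by (auto simp: insert_nth_def nth_append min_def nth_Cons')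

lemma insert_nth_eq_iff:
  assumes "i \<le> length xs" "length ys = length xs"
  shows "insert_nth i x xs = insert_nth i y ys \<longleftrightarrow> x = y \<and> xs = ys"
  using assms by (auto simp: insert_nth_def append_eq_append_conv) (metis append_take_drop_id)

lemma insert_nth_update:
  assumes "i \<le> length xs" "k < length xs"
  shows "insert_nth i x (xs[k := y]) = (insert_nth i x xs)[if k < i then k else Suc k := y]"
    and "insert_nth i x xs ! (if k < i then k else Suc k) = xs ! k"
proof -
  show "insert_nth i x (xs[k := y]) = (insert_nth i x xs)[if k < i then k else Suc k := y]"
    by (rule nth_equalityI)
      (use assms in \<open>auto simp: length_insert_nth nth_insert_nth nth_list_update less_Suc_eq_le\<close>)
  show "insert_nth i x xs ! (if k < i then k else Suc k) = xs ! k"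
    using assms by (simp add: nth_insert_nth)
qed

lemma step_insert_nth:
  assumes "i \<le> length xs"
  shows "step n i (insert_nth i j xs) = insert_nth i (nxt n j) xs"
    and "k < length xs \<Longrightarrow> step n (if k < i then k else Suc k) (insert_nth i j xs) = insert_nth i j (step n k xs)"
proof -
  have "insert_nth i j xs ! i = j" using assms by (simp add: nth_insert_nth)
  moreover have "(insert_nth i j xs)[i := y] = insert_nth i y xs" for y
    using assms by (simp add: insert_nth_def list_update_append min_def)
  ultimately show "step n i (insert_nth i j xs) = insert_nth i (nxt n j) xs"
    by (simp add: step_def)
  show "step n (if k < i then k else Suc k) (insert_nth i j xs) = insert_nth i j (step n k xs)" if "k < length xs"
    unfolding step_def insert_nth_update[OF assms that] ..
qed

lemma ex_insert_nth:
  assumes "i \<le> d" "zs \<in> verts (cart_power (cycle_graph n) (Suc d))"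
  obtains j xs where "zs = insert_nth i j xs" "j < n" "xs \<in> verts (cart_power (cycle_graph n) d)"
proof
  show "zs = insert_nth i (zs ! i) (take i zs @ drop (Suc i) zs)"
    using assms by (simp add: insert_nth_def verts_power min_def id_take_nth_drop[symmetric])
  show "zs ! i < n" using assms nth_mem[of i zs] by (force simp: verts_power)
  show "take i zs @ drop (Suc i) zs \<in> verts (cart_power (cycle_graph n) d)"
    using assms set_take_subset[of i zs] set_drop_subset[of "Suc i" zs] by (auto simp: verts_power)
qed

text \<open>
  Inserting a coordinate at position \<open>i\<close> presents the power as a product whose vertical edges
  are the edges of direction \<open>i\<close>. The other directions are those of the smaller power, where the
  directions from \<open>i\<close> on are shifted by one.
\<close>

lemma edges_power_insert_nth:
  fixes n :: nat
  assumes "i \<le> d"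
  defines "V \<equiv> verts (cart_power (cycle_graph n) d)" and "E \<equiv> edges (cart_power (cycle_graph n) d)"
  shows "edges (cart_power (cycle_graph n) (Suc d)) =
      {insert_nth i j ` e | j e. j < n \<and> e \<in> E} \<union>
      {{insert_nth i j xs, insert_nth i (nxt n j) xs} | j xs. j < n \<and> xs \<in> V}" (is ?edges)
    and "{{zs, step n i zs} | zs. zs \<in> verts (cart_power (cycle_graph n) (Suc d))} =
      {{insert_nth i j xs, insert_nth i (nxt n j) xs} | j xs. j < n \<and> xs \<in> V}" (is "?D = ?V")
proof -
  let ?V' = "verts (cart_power (cycle_graph n) (Suc d))"
  have len: "length xs = d" if "xs \<in> V" for xs using that by (simp add: V_def verts_power)
  have ins: "insert_nth i j xs \<in> ?V'" if "j < n" "xs \<in> V" for j xs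
    using that assms(1) by (simp add: V_def verts_power length_insert_nth set_insert_nth)
  have own: "step n i (insert_nth i j xs) = insert_nth i (nxt n j) xs" if "xs \<in> V" for j xs
    using step_insert_nth(1) len[OF that] assms(1) by simp
  have other: "step n (if k < i then k else Suc k) (insert_nth i j xs) = insert_nth i j (step n k xs)"
    if "xs \<in> V" "k < d" for j k xs
    using step_insert_nth(2) len[OF that(1)] that(2) assms(1) by simp
  show D: "?D = ?V"
  proof (rule set_eqI, rule iffI)
    fix e assume "e \<in> ?D"
    then obtain zs where zs: "e = {zs, step n i zs}" "zs \<in> ?V'" by blast
    obtain j xs where "zs = insert_nth i j xs" "j < n" "xs \<in> V"
      using ex_insert_nth[OF assms(1) zs(2)] unfolding V_def by blast
    then have "e = {insert_nth i j xs, insert_nth i (nxt n j) xs}" "j < n" "xs \<in> V"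
      using own zs(1) by simp_all
    then show "e \<in> ?V" by blast
  next
    fix e assume "e \<in> ?V"
    then obtain j xs where xs: "e = {insert_nth i j xs, insert_nth i (nxt n j) xs}" "j < n" "xs \<in> V" by blast
    then have "e = {insert_nth i j xs, step n i (insert_nth i j xs)}" using own by simp
    then show "e \<in> ?D" using ins[OF xs(2,3)] by blast
  qed
  have "e \<in> {insert_nth i j ` e | j e. j < n \<and> e \<in> E} \<union> ?V"
    if "e \<in> edges (cart_power (cycle_graph n) (Suc d))" for e
  proof -
    from that obtain zs k where zs: "e = {zs, step n k zs}" "zs \<in> ?V'" "k < Suc d"
      unfolding edges_power by blast
    show ?thesis
    proof (cases "k = i")
      case True
      then have "e \<in> ?D" using zs by blast
      then show ?thesis using D by simp
    next
      case False
      obtain j xs where xs: "zs = insert_nth i j xs" "j < n" "xs \<in> V"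
        using ex_insert_nth[OF assms(1) zs(2)] unfolding V_def by blast
      define k' where "k' = (if k < i then k else k - 1)"
      have k': "k' < d" "k = (if k' < i then k' else Suc k')"
        using False zs(3) assms(1) by (auto simp: k'_def)
      have "e = insert_nth i j ` {xs, step n k' xs}"
        using zs(1) xs(1) other[OF xs(3) k'(1), of j] k'(2) by simp
      moreover have "{xs, step n k' xs} \<in> E" unfolding E_def edges_power using xs(3) k'(1) V_def by blast
      ultimately show ?thesis using xs(2) by blast
    qed
  qed
  moreover have "insert_nth i j ` e \<in> edges (cart_power (cycle_graph n) (Suc d))"
    if "j < n" "e \<in> E" for j e
  proof -
    from that(2) obtain xs k where xs: "e = {xs, step n k xs}" "xs \<in> V" "k < d"
      unfolding E_def edges_power V_def by blast
    have "insert_nth i j ` e = {insert_nth i j xs, step n (if k < i then k else Suc k) (insert_nth i j xs)}"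
      unfolding xs(1) other[OF xs(2,3)] by simp
    moreover have "(if k < i then k else Suc k) < Suc d" using xs(3) by simp
    ultimately show ?thesis unfolding edges_power using ins[OF that(1) xs(2)] by blast
  qed
  moreover have "e \<in> edges (cart_power (cycle_graph n) (Suc d))" if "e \<in> ?V" for e
  proof -
    have "e \<in> ?D" using that D by simp
    moreover have "i < Suc d" using assms(1) by simp
    ultimately show ?thesis unfolding edges_power by blast
  qed
  ultimately show ?edges by blast
qed

lemma directions_disjoint:
  assumes "3 \<le> n" "i < d" "k < d" "i \<noteq> k" "xs \<in> verts (cart_power (cycle_graph n) d)"
    "ys \<in> verts (cart_power (cycle_graph n) d)"
  shows "{xs, step n i xs} \<noteq> {ys, step n k ys}"
proof
  assume eq: "{xs, step n i xs} = {ys, step n k ys}"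
  have len: "length xs = d" "length ys = d" using assms by (auto simp: verts_power)
  have "xs ! i < n" using assms(2,5) nth_mem[of i xs] by (force simp: verts_power)
  then have "step n i xs ! i \<noteq> xs ! i" using len assms(1,2) by (auto simp: step_def nxt_if)
  moreover have "step n k ys ! i = ys ! i" using assms(4) by (simp add: step_def)
  ultimately show False using eq by (metis doubleton_eq_iff)
qed

text \<open>
  The palette is arbitrary, as the induction hypothesis is applied to the colours that the
  vertical edges leave over.
\<close>

lemma extend_precoloring:
  assumes "even n" "4 \<le> n" "finite K" "card K = 2 * d"
    and "E' \<subseteq> edges (cart_power (cycle_graph n) d)" "proper_edge_coloring E' K \<phi>" "card E' < 2 * d"
  shows "\<exists>f. proper_edge_coloring (edges (cart_power (cycle_graph n) d)) K f \<and> (\<forall>e\<in>E'. f e = \<phi> e)"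
  using assms(3-)
proof (induction d arbitrary: K E' \<phi>)
  case 0
  then show ?case by simp
next
  case (Suc d)
  let ?V = "verts (cart_power (cycle_graph n) d)"
  let ?E = "edges (cart_power (cycle_graph n) d)"
  let ?E1 = "edges (cart_power (cycle_graph n) (Suc d))"
  have simple: "e \<subseteq> verts (cart_power (cycle_graph n) d) \<and> card e = 2"
    if "e \<in> edges (cart_power (cycle_graph n) d)" for e d
    using simple_graph_cart_power[OF simple_graph_cycle_graph, of n d] assms(2) that
    by (simp add: simple_graph_def)
  have finite_edges: "finite (edges (cart_power (cycle_graph n) d))" for d
  proof (rule finite_subset)
    show "edges (cart_power (cycle_graph n) d) \<subseteq> Pow {xs. set xs \<subseteq> {..<n} \<and> length xs = d}"
      using simple by (fastforce simp: verts_power)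
  qed (simp add: finite_lists_length_eq)
  interpret layers ?V ?E n "2 * d" K
  proof
    show "{w, w'} \<notin> ?E" if "{v, w} \<in> ?E" "{v, w'} \<in> ?E" for v w w'
      using parity_edge[OF assms(1) that(1)] parity_edge[OF assms(1) that(2)]
        parity_edge[OF assms(1), of w w' d] by blast
    show "2 * d \<le> card {w. {v, w} \<in> ?E}" if "v \<in> ?V" for v
      using degree_power that assms(2) by simp
    show "\<exists>f. proper_edge_coloring ?E P f \<and> (\<forall>e\<in>A. f e = \<psi> e)"
      if "P \<subseteq> K" "card P = 2 * d" "A \<subseteq> ?E" "proper_edge_coloring A P \<psi>" "card A < 2 * d" for P A \<psi>
      using Suc.IH[of P A \<psi>] that finite_subset Suc.prems(1) by blast
  qed (use assms Suc.prems simple finite_edges in auto)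
  define D where "D i = E' \<inter> {{xs, step n i xs} | xs. xs \<in> verts (cart_power (cycle_graph n) (Suc d))}" for i
  have finE': "finite E'" using Suc.prems(3) finite_edges finite_subset by blast
  have "(\<Sum>i<Suc d. card (D i)) = card (\<Union>i<Suc d. D i)"
  proof (rule card_UN_disjoint[symmetric])
    show "\<forall>i\<in>{..<Suc d}. \<forall>j\<in>{..<Suc d}. i \<noteq> j \<longrightarrow> D i \<inter> D j = {}"
      using directions_disjoint[of n] assms(2) unfolding D_def by fastforce
  qed (use finE' in \<open>auto simp: D_def\<close>)
  also have "\<dots> \<le> card E'" by (rule card_mono) (use finE' in \<open>auto simp: D_def\<close>)
  finally have "(\<Sum>i<Suc d. card (D i)) < 2 * Suc d" using Suc.prems(5) by simp
  have "\<exists>i\<le>d. card (D i) \<le> 1"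
  proof (rule ccontr)
    assume "\<not> (\<exists>i\<le>d. card (D i) \<le> 1)"
    then have "2 \<le> card (D i)" if "i \<in> {..<Suc d}" for i
      using that by (metis Suc_1 lessThan_iff less_Suc_eq_le not_less_eq_eq)
    then have "(\<Sum>i<Suc d. 2) \<le> (\<Sum>i<Suc d. card (D i))" by (rule sum_mono)
    then show False using \<open>(\<Sum>i<Suc d. card (D i)) < 2 * Suc d\<close> by simp
  qed
  then obtain i where i: "i \<le> d" "card (D i) \<le> 1" by blast
  note E1 = edges_power_insert_nth[OF i(1), of n]
  show ?case unfolding E1(1)
  proof (rule extend_product)
    show "2 \<le> 2 * d \<or> ?E = {}" by (cases d) auto
    show "j = j' \<and> x = x'"
      if "x \<in> ?V" "x' \<in> ?V" "insert_nth i j x = insert_nth i j' x'" for j j' x x'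
      using that i(1) insert_nth_eq_iff[of i x x'] by (simp add: verts_power)
    show "E' \<subseteq> {insert_nth i j ` e | j e. j < n \<and> e \<in> ?E} \<union>
        {{insert_nth i j x, insert_nth i (nxt n j) x} | j x. j < n \<and> x \<in> ?V}"
      using Suc.prems(3) E1(1) by simp
    show "card (E' \<inter> {{insert_nth i j x, insert_nth i (nxt n j) x} | j x. j < n \<and> x \<in> ?V}) \<le> 1"
      using i(2) unfolding D_def E1(2) .
  qed (use Suc.prems finE' in auto)
qed

theorem theorem3p1:
  fixes d k :: nat and E' :: "nat list set set" and \<phi> :: "nat list set \<Rightarrow> nat"
  assumes "d \<ge> 1" and "k \<ge> 2"
    and "E' \<subseteq> edges (cart_power (cycle_graph (2 * k)) d)"
    and "proper_edge_coloring E' {1..2 * d} \<phi>"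
    and "card E' \<le> 2 * d - 1"
  shows "\<exists>f :: nat list set \<Rightarrow> nat.
    proper_edge_coloring (edges (cart_power (cycle_graph (2 * k)) d)) {1..2 * d} f \<and>
    (\<forall>e\<in>E'. f e = \<phi> e)"
  using assms by (intro extend_precoloring) auto

end
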